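(* Let $G=(V,\mathcal{E})$ be a connected undirected graph with $V=[d]$ and let $\widehat{Q}$ be a step (S1) estimate for $G$. Consider the step (S2) optimization problem $$\underset{\Gamma\in\mathcal{C}^d}{\text{minimize}}\ \ \langle\Gamma,\widehat{Q}\rangle-\log\det(\operatorname{CM}(\Gamma))\quad\text{subject to}\quad\Gamma_{ij}\le\Gamma_{ik}+\Gamma_{jk}\ \ \forall i,j,k\in C,\ \forall C\in\mathcal{C}(G).$$ Its Lagrange dual problem, i.e. the problem of maximizing $\inf_{\Gamma\in\mathcal{C}^d}L(\Gamma,\boldsymbol{\eta})$ over $\boldsymbol{\eta}\ge\mathbf{0}$, where $L$ is the Lagrangian of the step (S2) problem, is $$\check{\boldsymbol{\eta}}=\operatorname*{arg\,max}_{\boldsymbol{\eta}\ge\mathbf{0}}\ \log\left(\sum_{T\in\mathcal{T}}\prod_{ij\in T}Q_{ij}(\boldsymbol{\eta})\right)+(d-1),$$ where $\boldsymbol{\eta}\in\mathbb{R}^m$ and the objective is understood as $-\infty$ when $Q(\boldsymbol{\eta})\notin\mathcal{Q}$.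
   Context: Write $[d]=\{1,\ldots,d\}$ and $\mathbf{1}=(1,\ldots,1)^T\in\mathbb{R}^d$. Let $\mathbb{S}^d_0$ be the set of symmetric real $d\times d$ matrices with zero diagonal, with inner product $\langle A,B\rangle=\sum_{i<j}A_{ij}B_{ij}$; gradients $\nabla_\Gamma$ are taken with respect to this inner product, i.e. $\nabla_\Gamma h\in\mathbb{S}^d_0$ has $ij$-entry $\partial h/\partial\Gamma_{ij}$, where $(\Gamma_{ij})_{i<j}$ are the free coordinates. $\mathcal{C}^d$ is the cone of $\Gamma\in\mathbb{S}^d_0$ that are (strictly) conditionally negative definite, i.e. $\mathbf{x}^T\Gamma\mathbf{x}<0$ for all $\mathbf{x}\ne\mathbf{0}$ with $\mathbf{x}^T\mathbf{1}=0$. The Cayley--Menger matrix is the $(d+1)\times(d+1)$ matrix $\operatorname{CM}(\Gamma)=\begin{pmatrix}-\Gamma/2&\mathbf{1}\\-\mathbf{1}^T&0\end{pmatrix}$. For $Q\in\mathbb{S}^d_0$ let $\Theta$ be the symmetric matrix with $\Theta_{ij}=-Q_{ij}$ for $i\ne j$ and $\Theta_{ii}=\sum_{j\ne i}Q_{ij}$. The natural parameter space is $\mathcal{Q}=\{Q\in\mathbb{S}^d_0:\mathbf{x}^T\Theta\mathbf{x}>0\text{ for all }\mathbf{x}\ne\mathbf{0}\text{ with }\mathbf{x}^T\mathbf{1}=0\}$. The matrices $Q\in\mathcal{Q}$ are in bijection with $\Gamma\in\mathcal{C}^d$ via $\Gamma_{ij}=\Theta^+_{ii}+\Theta^+_{jj}-2\Theta^+_{ij}$,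 where $\Theta^+$ is the Moore--Penrose pseudo-inverse. $\mathcal{T}$ denotes the set of spanning trees of the complete graph on $[d]$ (each identified with its edge set). Step (S1) estimate: given a symmetric conditionally negative semidefinite matrix $\overline{\Gamma}\in\mathbb{S}_0^d$ (the empirical variogram of the data), $\widehat{Q}$ is the (assumed to exist, then unique) minimizer of $\langle\overline{\Gamma},Q\rangle-\log\big(\sum_{T\in\mathcal{T}}\prod_{ij\in T}Q_{ij}\big)$ over $\{Q\in\mathcal{Q}:Q_{ij}=0\ \forall ij\notin\mathcal{E}\}$. $\mathcal{C}(G)$ is the set of cliques (inclusion-maximal complete subgraphs, identified with their vertex sets) of $G$. Let $\Delta$ be the set of triples $(i,j,k)$ with $i<j<k$ that are pairwise adjacent in $G$ (triangles), let $\Psi=\bigcup_{(i,j,k)\in\Delta}\{(i,j,k),(i,k,j),(j,k,i)\}$, and $m=3|\Delta|=|\Psi|$. For $(i,j,k)\in\Psi$ put $g_{ijk}=g_{ijk}(\Gamma)=\Gamma_{ij}-\Gamma_{ik}-\Gamma_{jk}$; the constraints of the step (S2) problem are $g_{ijk}\le 0$ for all $(i,j,k)\in\Psi$. Vectors $\boldsymbol{\eta}=(\eta_{ijk})_{(i,j,k)\in\Psi}\in\mathbb{R}^m$ are the KKT multipliers, and the Lagrangian is $$L(\Gamma,\boldsymbol{\eta})=\langle\Gamma,\widehat{Q}\rangle-\log\det(\operatorname{CM}(\Gamma))+\sum_{(i,j,k)\in\Psi}\eta_{ijk}\,g_{ijk}(\Gamma).$$ Finally, $Q(\boldsymbol{\eta})=\widehat{Q}+\sum_{(i,j,k)\in\Psi}\eta_{ijk}\nabla_\Gamma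 g_{ijk}\in\mathbb{S}^d_0$. *)

theory Defs
  imports
    "HOL-Analysis.Derivative"
    "HOL-Library.Extended_Real"
    "HOL-Library.FuncSet"
    "Jordan_Normal_Form.Determinant"
begin

text \<open>
  The vertex set is \<open>{0..<d}\<close> and not \<open>{1..d}\<close>, in accordance with the row and column indices of
  \<open>d \<times> d\<close> matrices. An undirected edge between \<open>i\<close> and \<open>j\<close> is represented by the pair with the
  smaller endpoint first, so a set of edges is a subset of \<open>edges d\<close>, and \<open>A $$ e\<close> is the
  entry of a symmetric matrix \<open>A\<close> at an edge \<open>e\<close>.
\<close>

definition edges :: "nat \<Rightarrow> (nat \<times> nat) set" where
  "edges d = {(i, j). i < j \<and> j < d}"

definition adjacent :: "(nat \<times> nat) set \<Rightarrow> nat \<Rightarrow> nat \<Rightarrow> bool" where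
  "adjacent E i j \<longleftrightarrow> (i, j) \<in> E \<or> (j, i) \<in> E"

definition connected_graph :: "nat \<Rightarrow> (nat \<times> nat) set \<Rightarrow> bool" where
  "connected_graph d E \<longleftrightarrow> (\<forall>i<d. \<forall>j<d. (adjacent E)\<^sup>*\<^sup>* i j)"

definition is_cycle :: "(nat \<times> nat) set \<Rightarrow> nat list \<Rightarrow> bool" where
  "is_cycle E p \<longleftrightarrow> length p \<ge> 3 \<and> distinct p \<and>
     (\<forall>n. Suc n < length p \<longrightarrow> adjacent E (p ! n) (p ! Suc n)) \<and> adjacent E (last p) (hd p)"

text \<open>
  The notion \<open>forest\<close> of the AFP entry Graph Theory is about directed cycles (a pair of opposite
  arcs is a cycle there), hence it does not express acyclicity of undirected graphs.
\<close>

definition spanning_trees :: "nat \<Rightarrow> (nat \<times> nat) set set" where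
  "spanning_trees d = {T. T \<subseteq> edges d \<and> connected_graph d T \<and> (\<nexists>p. is_cycle T p)}"

definition is_complete :: "nat \<Rightarrow> (nat \<times> nat) set \<Rightarrow> nat set \<Rightarrow> bool" where
  "is_complete d E C \<longleftrightarrow> C \<subseteq> {0..<d} \<and> (\<forall>i\<in>C. \<forall>j\<in>C. i \<noteq> j \<longrightarrow> adjacent E i j)"

definition cliques :: "nat \<Rightarrow> (nat \<times> nat) set \<Rightarrow> nat set set" where
  "cliques d E = {C. is_complete d E C \<and> (\<forall>C'. is_complete d E C' \<and> C \<subseteq> C' \<longrightarrow> C' = C)}"

definition sym0 :: "nat \<Rightarrow> real mat set" where
  "sym0 d = {A \<in> carrier_mat d d. transpose_mat A = A \<and> (\<forall>i<d. A $$ (i, i) = 0)}"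

definition inner0 :: "nat \<Rightarrow> real mat \<Rightarrow> real mat \<Rightarrow> real" where
  "inner0 d A B = (\<Sum>e\<in>edges d. A $$ e * B $$ e)"

definition sum_zero_vecs :: "nat \<Rightarrow> real vec set" where
  "sum_zero_vecs d = {x \<in> carrier_vec d. x \<bullet> vec d (\<lambda>_. 1) = 0}"

definition cnd_cone :: "nat \<Rightarrow> real mat set" where
  "cnd_cone d = {\<Gamma> \<in> sym0 d. \<forall>x\<in>sum_zero_vecs d. x \<noteq> 0\<^sub>v d \<longrightarrow> x \<bullet> (\<Gamma> *\<^sub>v x) < 0}"

definition cond_neg_semidef :: "nat \<Rightarrow> real mat \<Rightarrow> bool" where
  "cond_neg_semidef d \<Gamma> \<longleftrightarrow> (\<forall>x\<in>sum_zero_vecs d. x \<bullet> (\<Gamma> *\<^sub>v x) \<le> 0)"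

definition CM :: "nat \<Rightarrow> real mat \<Rightarrow> real mat" where
  "CM d \<Gamma> = four_block_mat ((- 1 / 2) \<cdot>\<^sub>m \<Gamma>) (mat d 1 (\<lambda>_. 1)) (mat 1 d (\<lambda>_. - 1)) (0\<^sub>m 1 1)"

definition Theta :: "nat \<Rightarrow> real mat \<Rightarrow> real mat" where
  "Theta d Q = mat d d (\<lambda>(i, j). if i = j then (\<Sum>k\<in>{0..<d} - {i}. Q $$ (i, k)) else - Q $$ (i, j))"

definition Q_space :: "nat \<Rightarrow> real mat set" where
  "Q_space d = {Q \<in> sym0 d. \<forall>x\<in>sum_zero_vecs d. x \<noteq> 0\<^sub>v d \<longrightarrow> x \<bullet> (Theta d Q *\<^sub>v x) > 0}"

definition tree_sum :: "nat \<Rightarrow> real mat \<Rightarrow> real" where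
  "tree_sum d Q = (\<Sum>T\<in>spanning_trees d. \<Prod>e\<in>T. Q $$ e)"

definition S1_estimate :: "nat \<Rightarrow> (nat \<times> nat) set \<Rightarrow> real mat \<Rightarrow> real mat \<Rightarrow> bool" where
  "S1_estimate d E \<Gamma>bar Qhat \<longleftrightarrow>
     is_arg_min (\<lambda>Q. inner0 d \<Gamma>bar Q - ln (tree_sum d Q))
       (\<lambda>Q. Q \<in> Q_space d \<and> (\<forall>e\<in>edges d - E. Q $$ e = 0)) Qhat"

definition S2_objective :: "nat \<Rightarrow> real mat \<Rightarrow> real mat \<Rightarrow> real" where
  "S2_objective d Qhat \<Gamma> = inner0 d \<Gamma> Qhat - ln (det (CM d \<Gamma>))"

definition S2_feasible :: "nat \<Rightarrow> (nat \<times> nat) set \<Rightarrow> real mat set" where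
  "S2_feasible d E = {\<Gamma> \<in> cnd_cone d. \<forall>C\<in>cliques d E. \<forall>i\<in>C. \<forall>j\<in>C. \<forall>k\<in>C.
     \<Gamma> $$ (i, j) \<le> \<Gamma> $$ (i, k) + \<Gamma> $$ (j, k)}"

definition triangles :: "nat \<Rightarrow> (nat \<times> nat) set \<Rightarrow> (nat \<times> nat \<times> nat) set" where
  "triangles d E =
     {(i, j, k). i < j \<and> j < k \<and> k < d \<and> adjacent E i j \<and> adjacent E i k \<and> adjacent E j k}"

definition Psi :: "nat \<Rightarrow> (nat \<times> nat) set \<Rightarrow> (nat \<times> nat \<times> nat) set" where
  "Psi d E = (\<Union>(i, j, k)\<in>triangles d E. {(i, j, k), (i, k, j), (j, k, i)})"

fun g :: "nat \<times> nat \<times> nat \<Rightarrow> real mat \<Rightarrow> real" where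
  "g (i, j, k) \<Gamma> = \<Gamma> $$ (i, j) - \<Gamma> $$ (i, k) - \<Gamma> $$ (j, k)"

definition multipliers :: "nat \<Rightarrow> (nat \<times> nat) set \<Rightarrow> (nat \<times> nat \<times> nat \<Rightarrow> real) set" where
  "multipliers d E = Psi d E \<rightarrow>\<^sub>E {0..}"

definition lagrangian ::
  "nat \<Rightarrow> (nat \<times> nat) set \<Rightarrow> real mat \<Rightarrow> real mat \<Rightarrow> (nat \<times> nat \<times> nat \<Rightarrow> real) \<Rightarrow> real" where
  "lagrangian d E Qhat \<Gamma> \<eta> = S2_objective d Qhat \<Gamma> + (\<Sum>\<psi>\<in>Psi d E. \<eta> \<psi> * g \<psi> \<Gamma>)"

definition dual_objective ::
  "nat \<Rightarrow> (nat \<times> nat) set \<Rightarrow> real mat \<Rightarrow> (nat \<times> nat \<times> nat \<Rightarrow> real) \<Rightarrow> ereal" where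
  "dual_objective d E Qhat \<eta> = (INF \<Gamma>\<in>cnd_cone d. ereal (lagrangian d E Qhat \<Gamma> \<eta>))"

text \<open>
  For \<open>i < j\<close>, the free coordinate \<open>\<Gamma>\<^sub>i\<^sub>j\<close> of \<open>sym0 d\<close> occupies the two entries \<open>(i, j)\<close> and \<open>(j, i)\<close>.
\<close>

definition set_coord :: "nat \<Rightarrow> real mat \<Rightarrow> nat \<Rightarrow> nat \<Rightarrow> real \<Rightarrow> real mat" where
  "set_coord d \<Gamma> i j t = mat d d (\<lambda>(a, b). if {a, b} = {i, j} then t else \<Gamma> $$ (a, b))"

definition grad0 :: "nat \<Rightarrow> (real mat \<Rightarrow> real) \<Rightarrow> real mat \<Rightarrow> real mat" where
  "grad0 d h \<Gamma> = mat d d (\<lambda>(i, j). if i = j then 0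
     else deriv (\<lambda>t. h (set_coord d \<Gamma> i j t)) (\<Gamma> $$ (i, j)))"

text \<open>
  Each \<open>g \<psi>\<close> is linear, so its gradient does not depend on the base point, which is taken
  to be the zero matrix in the definition of \<open>Q_eta\<close>.
\<close>

lemma grad0_g_const:
  assumes "\<psi> \<in> Psi d E"
  shows "grad0 d (g \<psi>) \<Gamma> = grad0 d (g \<psi>) \<Gamma>'"
proof -
  obtain i j k where \<psi>: "\<psi> = (i, j, k)" by (cases \<psi>)
  have ijk: "i < d" "j < d" "k < d"
    using assms by (auto simp: \<psi> Psi_def triangles_def)
  have entry: "((\<lambda>t. set_coord d A a b t $$ (u, v)) has_field_derivative
      (if {u, v} = {a, b} then 1 else 0)) (at x)" if "u < d" "v < d" for A a b u v x
    using that by (cases "{u, v} = {a, b}") (simp_all add: set_coord_def)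
  have *: "deriv (\<lambda>t. g \<psi> (set_coord d A a b t)) (A $$ (a, b)) =
      (if {i, j} = {a, b} then 1 else 0) - (if {i, k} = {a, b} then 1 else 0)
        - (if {j, k} = {a, b} then 1 else 0)" for A a b
    unfolding \<psi> g.simps by (intro DERIV_imp_deriv DERIV_diff entry ijk)
  show ?thesis
    unfolding grad0_def * ..
qed

definition Q_eta ::
  "nat \<Rightarrow> (nat \<times> nat) set \<Rightarrow> real mat \<Rightarrow> (nat \<times> nat \<times> nat \<Rightarrow> real) \<Rightarrow> real mat" where
  "Q_eta d E Qhat \<eta> = mat d d (\<lambda>(i, j).
     Qhat $$ (i, j) + (\<Sum>\<psi>\<in>Psi d E. \<eta> \<psi> * grad0 d (g \<psi>) (0\<^sub>m d d) $$ (i, j)))"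

definition tree_objective ::
  "nat \<Rightarrow> (nat \<times> nat) set \<Rightarrow> real mat \<Rightarrow> (nat \<times> nat \<times> nat \<Rightarrow> real) \<Rightarrow> ereal" where
  "tree_objective d E Qhat \<eta> =
     (if Q_eta d E Qhat \<eta> \<in> Q_space d
      then ereal (ln (tree_sum d (Q_eta d E Qhat \<eta>)) + (real d - 1))
      else - \<infinity>)"

end

theory Submission
  imports Defs "HOL-Library.Transitive_Closure_Table"
begin

text \<open>
  The Lagrangian is linear in \<open>\<Gamma>\<close> apart from the log-determinant, and every constraint \<open>g \<psi>\<close> is a
  linear form whose Riesz representative for \<open>inner0\<close> is its gradient. Hence
  \<open>lagrangian d E Qhat \<Gamma> \<eta> = inner0 d \<Gamma> Q - ln (det (CM d \<Gamma>))\<close> with \<open>Q = Q_eta d E Qhat \<eta>\<close>, and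
  what remains is the convex conjugate of the log-determinant: for every \<open>Q \<in> sym0 d\<close> the
  infimum of this expression over the cone is \<open>ln (tree_sum d Q) + (d - 1)\<close> if \<open>Q \<in> Q_space d\<close>, and
  \<open>-\<infinity>\<close> otherwise (lemma \<open>INF_log_det\<close>).

  Write \<open>d = n + 1\<close> and single out the vertex \<open>n\<close> as a root. The Farris transform turns \<open>\<Gamma>\<close> into the
  \<open>n \<times> n\<close> matrix \<open>S\<close> with \<open>S\<^sub>i\<^sub>j = (\<Gamma>\<^sub>i\<^sub>n + \<Gamma>\<^sub>j\<^sub>n - \<Gamma>\<^sub>i\<^sub>j) / 2\<close>, and \<open>Q\<close> corresponds to the block \<open>L\<close> of \<open>\<Theta>\<close>
  that omits the row and column of the root. In these coordinates the cone becomes the set of all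
  positive definite matrices \<open>S\<close>, membership in \<open>Q_space d\<close> says that \<open>L\<close> is positive definite,
  \<open>inner0 d \<Gamma> Q\<close> is the trace of \<open>S L\<close>, and \<open>det (CM d \<Gamma>) = det S\<close> by a Schur complement.

  For positive definite \<open>L\<close>, the bound \<open>tr (S L) - ln (det S) \<ge> n + ln (det L)\<close> is the inequality
  \<open>n + ln (det M) \<le> tr M\<close> for \<open>M = C\<^sup>T L C\<close>, where \<open>S = C C\<^sup>T\<close>; with a Cholesky factor of \<open>M\<close> the
  latter is a sum of scalar inequalities \<open>1 + ln t \<le> t\<close>. Equality holds at the inverse of \<open>L\<close>. If
  \<open>L\<close> is not positive definite, then stretching \<open>S\<close> along a vector \<open>x\<close> with \<open>x \<bullet> L x \<le> 0\<close> keeps the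
  trace bounded and makes the determinant arbitrarily large.

  Finally \<open>det L = tree_sum d Q\<close> is the matrix-tree theorem. Expanding the determinant along its rows
  gives a sum over all functions \<open>f\<close> that choose a parent for every vertex other than the root;
  such a function contributes its product of weights if following parents always ends at
  the root, and nothing otherwise. The contributing functions are the spanning trees, each
  directed towards the root.
\<close>

text \<open>
  Below, \<open>$\<close> and \<open>\<bullet>\<close> refer to vectors whose dimension is a number and not a type.
\<close>

unbundle no vec_syntax
unbundle no inner_syntax

section \<open>Spanning trees as rooted parent functions\<close>

text \<open>
  Acyclicity of a parent function, as the existence of a rank that drops from each vertex to its
  parent. When parents lie in \<open>{0..n}\<close> this forces every chain of parents to end at the root \<open>n\<close>. Ranks
  replace all iteration of \<open>f\<close>: they serve as induction measures.
\<close>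

definition rooted :: "nat \<Rightarrow> (nat \<Rightarrow> nat) \<Rightarrow> bool" where
  "rooted n f \<longleftrightarrow> (\<exists>h::nat \<Rightarrow> nat. \<forall>i<n. h (f i) < h i)"

definition edge :: "nat \<Rightarrow> nat \<Rightarrow> nat \<times> nat" where
  "edge i j = (min i j, max i j)"

definition parent_edges :: "nat \<Rightarrow> (nat \<Rightarrow> nat) \<Rightarrow> (nat \<times> nat) set" where
  "parent_edges n f = (\<lambda>i. edge i (f i)) ` {0..<n}"

lemma edge_eq_iff: "edge a b = edge c d \<longleftrightarrow> (a = c \<and> b = d) \<or> (a = d \<and> b = c)"
  by (auto simp: edge_def min_def max_def)

lemma edge_in_edges: "a \<noteq> b \<Longrightarrow> a < d \<Longrightarrow> b < d \<Longrightarrow> edge a b \<in> edges d"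
  by (auto simp: edge_def edges_def min_def max_def)

lemma adjacent_sym: "adjacent E a b \<longleftrightarrow> adjacent E b a"
  by (auto simp: adjacent_def)

lemma adjacent_iff_edge:
  assumes "E \<subseteq> edges d"
  shows "adjacent E a b \<longleftrightarrow> edge a b \<in> E"
  using assms by (auto simp: edge_def edges_def adjacent_def min_def max_def)

lemma rooted_parent_neq: "rooted n f \<Longrightarrow> i < n \<Longrightarrow> f i \<noteq> i"
  unfolding rooted_def by (metis less_irrefl)

lemma parent_edges_subset:
  assumes "rooted n f" "f \<in> {0..<n} \<rightarrow>\<^sub>E {0..n}"
  shows "parent_edges n f \<subseteq> edges (Suc n)"
proof -
  have "edge i (f i) \<in> edges (Suc n)" if "i < n" for i
    using assms that rooted_parent_neq[OF assms(1), of i]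
    by (intro edge_in_edges) (auto simp: PiE_iff le_imp_less_Suc)
  then show ?thesis by (auto simp: parent_edges_def)
qed

lemma adjacent_parent_edges_iff:
  assumes "rooted n f" "f \<in> {0..<n} \<rightarrow>\<^sub>E {0..n}"
  shows "adjacent (parent_edges n f) a b \<longleftrightarrow> (a < n \<and> b = f a) \<or> (b < n \<and> a = f b)"
  unfolding adjacent_iff_edge[OF parent_edges_subset[OF assms]]
  by (auto simp: parent_edges_def edge_eq_iff)

lemma connected_graphI_root:
  assumes "\<And>i. i < n \<Longrightarrow> (adjacent E)\<^sup>*\<^sup>* i n"
  shows "connected_graph (Suc n) E"
  unfolding connected_graph_def
proof (intro allI impI)
  fix i j assume ij: "i < Suc n" "j < Suc n"
  have r: "(adjacent E)\<^sup>*\<^sup>* i n" if "i < Suc n" for i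
    using assms that by (cases "i = n") auto
  have "symp ((adjacent E)\<^sup>*\<^sup>*)"
    by (intro symp_rtranclp) (simp add: symp_def adjacent_sym)
  then have "(adjacent E)\<^sup>*\<^sup>* n j" using r[OF ij(2)] by (auto dest: sympD)
  with r[OF ij(1)] show "(adjacent E)\<^sup>*\<^sup>* i j" by (rule rtranclp_trans)
qed

text \<open>
  This turns the list representation of cycles into the only property of cycles that matters below:
  each vertex of a cycle sees two different vertices of the cycle.
\<close>

lemma cycle_vertex_two_neighbours:
  assumes "is_cycle E p" "m \<in> set p"
  obtains a b where "a \<in> set p" "b \<in> set p" "a \<noteq> b" "adjacent E m a" "adjacent E m b"
proof -
  let ?l = "length p"
  have l: "?l \<ge> 3" and d: "distinct p" and last: "adjacent E (last p) (hd p)"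
    and adj: "\<And>k. Suc k < ?l \<Longrightarrow> adjacent E (p ! k) (p ! Suc k)"
    using assms by (auto simp: is_cycle_def)
  have ne: "p \<noteq> []" using l by auto
  have lasthd: "adjacent E (p ! (?l - 1)) (p ! 0)"
    using last ne by (simp add: last_conv_nth hd_conv_nth)
  obtain i where i: "i < ?l" "m = p ! i" using assms(2) by (auto simp: in_set_conv_nth)
  define a where "a = (if Suc i < ?l then Suc i else 0)"
  define b where "b = (if i = 0 then ?l - 1 else i - 1)"
  have ab: "a < ?l" "b < ?l" "a \<noteq> b" using l i by (auto simp: a_def b_def)
  show ?thesis
  proof (rule that)
    show "p ! a \<noteq> p ! b" using ab d by (simp add: nth_eq_iff_index_eq)
    show "adjacent E m (p ! a)"
    proof (cases "Suc i < ?l")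
      case False
      then have "i = ?l - 1" using i by simp
      then show ?thesis using lasthd False i by (simp add: a_def)
    qed (use adj i in \<open>simp add: a_def\<close>)
    show "adjacent E m (p ! b)"
    proof (cases i)
      case 0
      then show ?thesis using lasthd i by (simp add: b_def adjacent_sym)
    next
      case (Suc k)
      then show ?thesis using adj[of k] i by (simp add: b_def adjacent_sym)
    qed
  qed (use ab in auto)
qed

text \<open>
  On a cycle, a vertex of maximal rank could only be joined to its own parent, because a child
  would have a larger rank; but it has two different neighbours on the cycle.
\<close>

lemma spanning_tree_parent_edges:
  assumes "rooted n f" "f \<in> {0..<n} \<rightarrow>\<^sub>E {0..n}"
  shows "parent_edges n f \<in> spanning_trees (Suc n)"
proof -
  note adj = adjacent_parent_edges_iff[OF assms]
  obtain h :: "nat \<Rightarrow> nat" where h: "\<And>i. i < n \<Longrightarrow> h (f i) < h i"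
    using assms(1) by (auto simp: rooted_def)
  have reach: "(adjacent (parent_edges n f))\<^sup>*\<^sup>* i n" if "i < n" for i
    using that
  proof (induction "h i" arbitrary: i rule: less_induct)
    case less
    have "f i \<le> n" using assms(2) less.prems by (auto simp: PiE_iff)
    then have "(adjacent (parent_edges n f))\<^sup>*\<^sup>* (f i) n"
      using less h by (cases "f i = n") auto
    moreover have "adjacent (parent_edges n f) i (f i)" using less.prems adj by blast
    ultimately show ?case by (rule converse_rtranclp_into_rtranclp[rotated])
  qed
  have "\<not> is_cycle (parent_edges n f) p" for p
  proof
    assume c: "is_cycle (parent_edges n f) p"
    then have "p \<noteq> []" by (auto simp: is_cycle_def)
    then have "Max (h ` set p) \<in> h ` set p" by (intro Max_in) auto
    then obtain m where m: "m \<in> set p" "h m = Max (h ` set p)" by auto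
    have max: "h x \<le> h m" if "x \<in> set p" for x using that m by auto
    have parent: "x = f m" if "x \<in> set p" "adjacent (parent_edges n f) m x" for x
      using that max[of x] h[of x] unfolding adj by auto
    show False using cycle_vertex_two_neighbours[OF c m(1)] parent by metis
  qed
  then show ?thesis
    using parent_edges_subset[OF assms] connected_graphI_root[OF reach]
    by (auto simp: spanning_trees_def)
qed

text \<open>
  A further edge of \<open>T\<close> would close a cycle with a simple path of \<open>T'\<close> between its endpoints.
\<close>

lemma spanning_tree_minimal:
  assumes "T \<subseteq> edges d" "\<nexists>p. is_cycle T p" "T' \<subseteq> T" "connected_graph d T'"
  shows "T' = T"
proof (rule ccontr)
  assume "T' \<noteq> T"
  then obtain a b where ab: "(a, b) \<in> T" "(a, b) \<notin> T'" using assms(3) by auto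
  then have lt: "a < b" "b < d" using assms(1) by (auto simp: edges_def)
  then have "(adjacent T')\<^sup>*\<^sup>* a b" using assms(4) by (auto simp: connected_graph_def)
  then obtain xs0 where "rtrancl_path (adjacent T') a xs0 b"
    by (auto simp: rtranclp_eq_rtrancl_path)
  then obtain xs where xs: "rtrancl_path (adjacent T') a xs b" "distinct (a # xs)"
    by (rule rtrancl_path_distinct)
  have ne: "xs \<noteq> []" using xs(1) lt by (auto elim: rtrancl_path.cases)
  have last: "last xs = b" using rtrancl_path_last[OF xs(1) ne] .
  have step: "adjacent T' ((a # xs) ! k) (xs ! k)" if "k < length xs" for k
    using rtrancl_path_nth[OF xs(1) that] .
  have mono: "adjacent T x y" if "adjacent T' x y" for x y
    using that assms(3) by (auto simp: adjacent_def)
  have "length xs \<noteq> 1"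
  proof
    assume l: "length xs = 1"
    then have "xs = [b]" using last by (cases xs) auto
    then have "adjacent T' a b" using step[of 0] by simp
    then have "(b, a) \<in> T" using ab assms(3) by (auto simp: adjacent_def)
    then show False using lt assms(1) by (auto simp: edges_def)
  qed
  then have "length (a # xs) \<ge> 3" using ne by (cases xs; cases "tl xs") auto
  moreover have "adjacent T (last (a # xs)) (hd (a # xs))"
    using last ne ab by (simp add: adjacent_def)
  moreover have "adjacent T ((a # xs) ! k) ((a # xs) ! Suc k)" if "Suc k < length (a # xs)" for k
    using step[of k] that mono by simp
  ultimately have "is_cycle T (a # xs)" using xs(2) by (simp add: is_cycle_def)
  then show False using assms(2) by blast
qed

text \<open>
  The rank is the distance to \<open>n\<close>. It yields the parent function of a tree, and it also
  shows that a parent function under which all vertices reach the root is rooted.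
\<close>

lemma rank_from_reachability:
  assumes "\<And>i. i < n \<Longrightarrow> r\<^sup>*\<^sup>* i n"
  obtains h :: "nat \<Rightarrow> nat" where "\<And>i. i < n \<Longrightarrow> \<exists>j. r i j \<and> h j < h i"
proof
  define h where "h i = (LEAST k. (r ^^ k) i n)" for i
  fix i assume i: "i < n"
  have hi: "(r ^^ h i) i n"
    unfolding h_def by (rule LeastI_ex) (use assms[OF i] in \<open>simp add: rtranclp_power\<close>)
  then obtain k where k: "h i = Suc k" using i by (cases "h i") auto
  obtain j where j: "r i j" "(r ^^ k) j n" using hi unfolding k by (rule relpowp_Suc_E2)
  have "h j \<le> k" unfolding h_def using j(2) by (rule Least_le)
  then show "\<exists>j. r i j \<and> h j < h i" using j(1) k by (intro exI[of _ j]) simp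
qed

text \<open>
  Each vertex chooses a neighbour closer to the root. The chosen edges already form a spanning tree
  inside \<open>T\<close>, hence are all of \<open>T\<close>.
\<close>

lemma parent_function_exists:
  assumes "T \<in> spanning_trees (Suc n)"
  obtains f where "f \<in> {0..<n} \<rightarrow>\<^sub>E {0..n}" "rooted n f" "parent_edges n f = T"
proof -
  have T: "T \<subseteq> edges (Suc n)" "connected_graph (Suc n) T" "\<nexists>p. is_cycle T p"
    using assms by (auto simp: spanning_trees_def)
  obtain h :: "nat \<Rightarrow> nat" where h: "\<And>i. i < n \<Longrightarrow> \<exists>j. adjacent T i j \<and> h j < h i"
    by (rule rank_from_reachability[of n "adjacent T"])
      (use T(2) in \<open>auto simp: connected_graph_def\<close>)
  define f where "f = (\<lambda>i\<in>{0..<n}. SOME j. adjacent T i j \<and> h j < h i)"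
  have f: "adjacent T i (f i)" "h (f i) < h i" if "i < n" for i
    using someI_ex[OF h[OF that]] that by (auto simp: f_def)
  have "f i \<le> n" if "i < n" for i
    using f(1)[OF that] T(1) by (auto simp: adjacent_def edges_def)
  then have fP: "f \<in> {0..<n} \<rightarrow>\<^sub>E {0..n}" by (auto simp: PiE_iff f_def)
  have fr: "rooted n f" using f(2) by (auto simp: rooted_def)
  have "parent_edges n f \<subseteq> T"
    using f(1) by (auto simp: parent_edges_def adjacent_iff_edge[OF T(1)])
  moreover have "connected_graph (Suc n) (parent_edges n f)"
    using spanning_tree_parent_edges[OF fr fP] by (simp add: spanning_trees_def)
  ultimately have "parent_edges n f = T" by (rule spanning_tree_minimal[OF T(1) T(3)])
  with fP fr show ?thesis by (rule that)
qed

text \<open>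
  By induction on the rank of \<open>i\<close> under the second function: the edge from \<open>i\<close> to \<open>f' i\<close> belongs to the
  tree of \<open>f\<close>, so either \<open>f i = f' i\<close> or \<open>i\<close> is the \<open>f\<close>-parent, hence also the \<open>f'\<close>-parent, of \<open>f' i\<close>.
  The latter contradicts the ranks.
\<close>

lemma parent_function_unique:
  assumes f: "f \<in> {0..<n} \<rightarrow>\<^sub>E {0..n}" "rooted n f"
    and f': "f' \<in> {0..<n} \<rightarrow>\<^sub>E {0..n}" "rooted n f'"
    and eq: "parent_edges n f = parent_edges n f'"
  shows "f = f'"
proof -
  obtain h :: "nat \<Rightarrow> nat" where h: "\<And>i. i < n \<Longrightarrow> h (f' i) < h i"
    using f'(2) by (auto simp: rooted_def)
  have "f i = f' i" if "i < n" for i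
    using that
  proof (induction "h i" arbitrary: i rule: less_induct)
    case less
    have "adjacent (parent_edges n f) i (f' i)"
      unfolding eq adjacent_parent_edges_iff[OF f'(2) f'(1)] using less.prems by blast
    then consider "f' i = f i" | "f' i < n" "i = f (f' i)"
      unfolding adjacent_parent_edges_iff[OF f(2) f(1)] by blast
    then show ?case
    proof cases
      case 2
      then have "f (f' i) = f' (f' i)" using less h by blast
      then show ?thesis using 2 h[of i] h[of "f' i"] less.prems by simp
    qed simp
  qed
  then show ?thesis using f(1) f'(1) by (intro PiE_ext) auto
qed

lemma parent_edges_bij:
  "bij_betw (parent_edges n) {f \<in> {0..<n} \<rightarrow>\<^sub>E {0..n}. rooted n f} (spanning_trees (Suc n))"
  unfolding bij_betw_def
proof
  show "inj_on (parent_edges n) {f \<in> {0..<n} \<rightarrow>\<^sub>E {0..n}. rooted n f}"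
    by (auto intro!: inj_onI parent_function_unique)
  show "parent_edges n ` {f \<in> {0..<n} \<rightarrow>\<^sub>E {0..n}. rooted n f} = spanning_trees (Suc n)"
    using spanning_tree_parent_edges by (auto elim!: parent_function_exists)
qed

lemma prod_parent_edges:
  fixes Q :: "real mat"
  assumes "rooted n f" "f \<in> {0..<n} \<rightarrow>\<^sub>E {0..n}" and Q: "Q \<in> sym0 (Suc n)"
  shows "(\<Prod>e\<in>parent_edges n f. Q $$ e) = (\<Prod>i = 0..<n. Q $$ (i, f i))"
proof -
  obtain h :: "nat \<Rightarrow> nat" where h: "\<And>i. i < n \<Longrightarrow> h (f i) < h i"
    using assms(1) by (auto simp: rooted_def)
  have inj: "inj_on (\<lambda>i. edge i (f i)) {0..<n}"
    using h by (intro inj_onI) (metis atLeastLessThan_iff edge_eq_iff less_asym)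
  have "Q $$ edge i (f i) = Q $$ (i, f i)" if "i < n" for i
  proof -
    have "f i < Suc n" using assms(2) that by (auto simp: PiE_iff less_Suc_eq_le)
    then have "Q $$ (f i, i) = Q $$ (i, f i)"
      using Q that by (metis (mono_tags, lifting) carrier_matD index_transpose_mat(1) less_SucI mem_Collect_eq sym0_def)
    then show ?thesis by (auto simp: edge_def min_def max_def)
  qed
  then show ?thesis
    unfolding parent_edges_def prod.reindex[OF inj] by simp
qed

section \<open>The matrix-tree theorem\<close>

text \<open>
  Multilinearity of the determinant in its rows, used for all rows at once.
\<close>

lemma det_row_sums:
  fixes c :: "nat \<Rightarrow> 'k \<Rightarrow> real"
  assumes "finite K"
  shows "det (mat n n (\<lambda>(i, j). \<Sum>k\<in>K. c i k * b i k j)) =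
    (\<Sum>f\<in>{0..<n} \<rightarrow>\<^sub>E K. (\<Prod>i = 0..<n. c i (f i)) * det (mat n n (\<lambda>(i, j). b i (f i) j)))"
proof -
  have "det (mat n n (\<lambda>(i, j). \<Sum>k\<in>K. c i k * b i k j)) =
      (\<Sum>p | p permutes {0..<n}. signof p * (\<Prod>i = 0..<n. \<Sum>k\<in>K. c i k * b i k (p i)))"
    by (subst det_def'[of _ n]) (auto intro!: sum.cong prod.cong dest: permutes_in_image)
  also have "\<dots> = (\<Sum>p | p permutes {0..<n}. \<Sum>f\<in>{0..<n} \<rightarrow>\<^sub>E K.
      (\<Prod>i = 0..<n. c i (f i)) * (signof p * (\<Prod>i = 0..<n. b i (f i) (p i))))"
    using assms by (subst prod_sum_PiE)
      (auto simp: sum_distrib_left prod.distrib mult_ac intro!: sum.cong)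
  also have "\<dots> = (\<Sum>f\<in>{0..<n} \<rightarrow>\<^sub>E K. \<Sum>p | p permutes {0..<n}.
      (\<Prod>i = 0..<n. c i (f i)) * (signof p * (\<Prod>i = 0..<n. b i (f i) (p i))))"
    by (rule sum.swap)
  also have "\<dots> = (\<Sum>f\<in>{0..<n} \<rightarrow>\<^sub>E K.
      (\<Prod>i = 0..<n. c i (f i)) * det (mat n n (\<lambda>(i, j). b i (f i) j)))"
    by (subst det_def'[of _ n])
      (auto simp: sum_distrib_left intro!: sum.cong prod.cong dest: permutes_in_image)
  finally show ?thesis .
qed

text \<open>
  The identity matrix minus the adjacency matrix of the functional graph of \<open>f\<close>; an arrow into the
  root \<open>n\<close> leaves no trace, since \<open>n\<close> is not an index.
\<close>

definition parent_matrix :: "nat \<Rightarrow> (nat \<Rightarrow> nat) \<Rightarrow> real mat" where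
  "parent_matrix n f = mat n n (\<lambda>(i, j). of_bool (j = i) - of_bool (j = f i))"

text \<open>
  In the Leibniz expansion only the identity survives: a permutation with a nonzero product moves
  each vertex to itself or to its parent, and so cannot increase any rank.
\<close>

lemma det_parent_matrix_rooted:
  assumes "rooted n f"
  shows "det (parent_matrix n f) = 1"
proof -
  obtain h :: "nat \<Rightarrow> nat" where h: "\<And>i. i < n \<Longrightarrow> h (f i) < h i"
    using assms by (auto simp: rooted_def)
  have zero: "(\<Prod>i = 0..<n. parent_matrix n f $$ (i, p i)) = 0"
    if p: "p permutes {0..<n}" "p \<noteq> id" for p
  proof (rule ccontr)
    assume "(\<Prod>i = 0..<n. parent_matrix n f $$ (i, p i)) \<noteq> 0"
    then have step: "p i = i \<or> p i = f i" if "i < n" for i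
      using that p(1) by (force simp: parent_matrix_def permutes_in_image split: if_splits)
    have le: "h (p i) \<le> h i" if "i < n" for i
      using step[OF that] h[OF that] by auto
    \<comment> \<open>Permuting the summands does not change the total rank, so no vertex may move down.\<close>
    have "(\<Sum>i = 0..<n. h (p i)) = (\<Sum>i = 0..<n. h i)"
      using sum.permute[OF p(1), of h] by (simp add: o_def)
    then have "h (p i) = h i" if "i < n" for i
      using that le sum_mono_inv[of "\<lambda>i. h (p i)" "{0..<n}" h i] by auto
    then have "p i = i" if "i < n" for i
      using step[OF that] h[OF that] that by force
    then have "p = id" using p(1) by (intro ext) (metis atLeastLessThan_iff id_apply permutes_not_in zero_le)
    then show False using p(2) by simp
  qed
  have "f i \<noteq> i" if "i < n" for i using h[OF that] by auto
  then have one: "(\<Prod>i = 0..<n. parent_matrix n f $$ (i, id i)) = 1"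
    by (intro prod.neutral) (force simp: parent_matrix_def)
  have "det (parent_matrix n f) =
      (\<Sum>p | p permutes {0..<n}. if p = id then 1 else 0)"
    by (subst det_def'[of _ n]) (use zero one in \<open>auto simp: parent_matrix_def[of n f] sign_id intro!: sum.cong\<close>)
  also have "\<dots> = 1" by (simp add: finite_permutations permutes_id)
  finally show ?thesis .
qed

text \<open>
  The vertices that never reach the root form a nonempty set which \<open>f\<close> neither leaves nor enters,
  so its indicator vector lies in the kernel.
\<close>

lemma det_parent_matrix_not_rooted:
  assumes "\<not> rooted n f" "f \<in> {0..<n} \<rightarrow>\<^sub>E {0..n}"
  shows "det (parent_matrix n f) = 0"
proof -
  define r where "r a b \<longleftrightarrow> a < n \<and> b = f a" for a b
  define U where "U = {i. i < n \<and> \<not> r\<^sup>*\<^sup>* i n}"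
  have "U \<noteq> {}"
  proof
    assume "U = {}"
    then obtain h :: "nat \<Rightarrow> nat" where "\<And>i. i < n \<Longrightarrow> \<exists>j. r i j \<and> h j < h i"
      using rank_from_reachability[of n r] by (auto simp: U_def)
    then show False using assms by (auto simp: rooted_def r_def)
  qed
  then obtain u where u: "u < n" "u \<in> U" by (auto simp: U_def)
  have closed: "f i \<in> U \<longleftrightarrow> i \<in> U" if "i < n" for i
  proof (cases "f i = n")
    case True
    then show ?thesis using that by (auto simp: U_def r_def)
  next
    case False
    then have "f i < n" using assms(2) that by (auto simp: PiE_iff le_less)
    moreover have "r\<^sup>*\<^sup>* i n \<longleftrightarrow> r\<^sup>*\<^sup>* (f i) n"
    proof
      assume "r\<^sup>*\<^sup>* i n"
      then show "r\<^sup>*\<^sup>* (f i) n"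
        by (rule converse_rtranclpE) (use that in \<open>auto simp: r_def\<close>)
    next
      assume "r\<^sup>*\<^sup>* (f i) n"
      then show "r\<^sup>*\<^sup>* i n"
        by (rule converse_rtranclp_into_rtranclp[rotated]) (use that in \<open>simp add: r_def\<close>)
    qed
    ultimately show ?thesis using that by (simp add: U_def)
  qed
  define v :: "real vec" where "v = vec n (\<lambda>i. of_bool (i \<in> U))"
  have "v \<noteq> 0\<^sub>v n"
  proof
    assume "v = 0\<^sub>v n"
    then have "v $ u = 0" using u by simp
    then show False using u by (simp add: v_def)
  qed
  moreover have "parent_matrix n f *\<^sub>v v = 0\<^sub>v n"
  proof
    fix i assume "i < dim_vec (0\<^sub>v n :: real vec)"
    then have i: "i < n" by simp
    have "(parent_matrix n f *\<^sub>v v) $ i =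
        (\<Sum>j = 0..<n. (of_bool (j = i) - of_bool (j = f i)) * of_bool (j \<in> U))"
      using i by (simp add: parent_matrix_def v_def scalar_prod_def)
    also have "\<dots> = (\<Sum>j = 0..<n. (if j = i then of_bool (j \<in> U) else 0)) -
        (\<Sum>j = 0..<n. (if j = f i then of_bool (j \<in> U) else 0))"
      unfolding sum_subtractf[symmetric] by (intro sum.cong) auto
    also have "\<dots> = of_bool (i \<in> U) - of_bool (f i \<in> U)"
      using i by (auto simp: sum.delta' U_def)
    also have "\<dots> = 0" using closed[OF i] by simp
    finally show "(parent_matrix n f *\<^sub>v v) $ i = 0\<^sub>v n $ i" using i by simp
  qed (simp add: parent_matrix_def)
  moreover have "parent_matrix n f \<in> carrier_mat n n" "v \<in> carrier_vec n"
    by (simp_all add: parent_matrix_def v_def)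
  ultimately show ?thesis
    using det_0_iff_vec_prod_zero[of "parent_matrix n f" n] by blast
qed

definition reduced_laplacian :: "nat \<Rightarrow> real mat \<Rightarrow> real mat" where
  "reduced_laplacian n Q = mat n n (\<lambda>(i, j). Theta (Suc n) Q $$ (i, j))"

text \<open>
  Row \<open>i\<close> of the reduced Laplacian is the sum over \<open>k\<close> of \<open>Q\<^sub>i\<^sub>k\<close> times the difference of the unit vectors
  at \<open>i\<close> and \<open>k\<close>, the unit vector of the root being zero. The weights may have any sign.
\<close>

theorem matrix_tree:
  assumes Q: "Q \<in> sym0 (Suc n)"
  shows "tree_sum (Suc n) Q = det (reduced_laplacian n Q)"
proof -
  let ?F = "{0..<n} \<rightarrow>\<^sub>E {0..n}"
  have diag: "Q $$ (i, i) = 0" if "i < n" for i using Q that by (auto simp: sym0_def)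
  have "reduced_laplacian n Q =
      mat n n (\<lambda>(i, j). \<Sum>k\<in>{0..n}. Q $$ (i, k) * (of_bool (j = i) - of_bool (j = k)))"
    (is "_ = ?M")
  proof (rule eq_matI)
    fix i j assume "i < dim_row ?M" "j < dim_col ?M"
    then have ij: "i < n" "j < n" by simp_all
    have "(\<Sum>k\<in>{0..n}. Q $$ (i, k) * (of_bool (j = i) - of_bool (j = k))) =
        of_bool (j = i) * (\<Sum>k\<in>{0..n}. Q $$ (i, k)) - (\<Sum>k\<in>{0..n}. if k = j then Q $$ (i, k) else 0)"
      unfolding sum_distrib_left sum_subtractf[symmetric]
      by (intro sum.cong) (auto simp: algebra_simps)
    also have "\<dots> = of_bool (j = i) * (\<Sum>k\<in>{0..n}. Q $$ (i, k)) - Q $$ (i, j)"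
      using ij by (simp add: sum.delta')
    also have "(\<Sum>k\<in>{0..n}. Q $$ (i, k)) = (\<Sum>k\<in>{0..n} - {i}. Q $$ (i, k))"
      using ij diag by (subst sum.remove[of _ i]) auto
    finally have "?M $$ (i, j) =
        of_bool (j = i) * (\<Sum>k\<in>{0..n} - {i}. Q $$ (i, k)) - Q $$ (i, j)"
      using ij by simp
    also have "\<dots> = reduced_laplacian n Q $$ (i, j)"
      using ij diag by (auto simp: reduced_laplacian_def Theta_def atLeastLessThanSuc_atLeastAtMost)
    finally show "reduced_laplacian n Q $$ (i, j) = ?M $$ (i, j)" by simp
  qed (simp_all add: reduced_laplacian_def)
  then have "det (reduced_laplacian n Q) =
      (\<Sum>f\<in>?F. (\<Prod>i = 0..<n. Q $$ (i, f i)) * det (parent_matrix n f))"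
    by (simp only: parent_matrix_def det_row_sums[OF finite_atLeastAtMost])
  also have "\<dots> = (\<Sum>f\<in>{f \<in> ?F. rooted n f}. \<Prod>i = 0..<n. Q $$ (i, f i))"
    by (rule sum.mono_neutral_cong_right)
      (auto simp: finite_PiE det_parent_matrix_rooted det_parent_matrix_not_rooted)
  also have "\<dots> = (\<Sum>f\<in>{f \<in> ?F. rooted n f}. \<Prod>e\<in>parent_edges n f. Q $$ e)"
    using prod_parent_edges[OF _ _ Q] by (intro sum.cong) auto
  also have "\<dots> = tree_sum (Suc n) Q"
    unfolding tree_sum_def by (rule sum.reindex_bij_betw[OF parent_edges_bij])
  finally show ?thesis by simp
qed

section \<open>Positive definite matrices\<close>

definition pos_def :: "nat \<Rightarrow> real mat \<Rightarrow> bool" where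
  "pos_def n A \<longleftrightarrow> A \<in> carrier_mat n n \<and> transpose_mat A = A \<and>
     (\<forall>x\<in>carrier_vec n. x \<noteq> 0\<^sub>v n \<longrightarrow> x \<bullet> (A *\<^sub>v x) > 0)"

lemma quadratic_form_sum:
  fixes A :: "'a :: comm_semiring_0 mat"
  assumes "A \<in> carrier_mat n n" "x \<in> carrier_vec n"
  shows "x \<bullet> (A *\<^sub>v x) = (\<Sum>i<n. \<Sum>j<n. A $$ (i, j) * x $ i * x $ j)"
  using assms by (auto simp: scalar_prod_def sum_distrib_left mult_ac atLeast0LessThan intro!: sum.cong)

lemma symmetric_matD:
  assumes "A \<in> carrier_mat n n" "transpose_mat A = A" "i < n" "j < n"
  shows "A $$ (j, i) = A $$ (i, j)"
  using assms by (metis carrier_matD index_transpose_mat(1))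

text \<open>
  Induction on the size, removing the last index by a Schur complement. Entries are functions
  of indices here, so that the submatrix of the induction step needs no new carrier.
\<close>

lemma pos_def_Cholesky_sums:
  fixes a :: "nat \<Rightarrow> nat \<Rightarrow> real"
  assumes "\<And>i j. i < n \<Longrightarrow> j < n \<Longrightarrow> a j i = a i j"
    and "\<And>x. \<exists>i<n. x i \<noteq> 0 \<Longrightarrow> (\<Sum>i<n. \<Sum>j<n. a i j * x i * x j) > 0"
  shows "\<exists>c. (\<forall>i<n. c i i > 0) \<and> (\<forall>i<n. \<forall>k<i. c i k = 0) \<and>
    (\<forall>i<n. \<forall>j<n. a i j = (\<Sum>k<n. c i k * c j k))"
  using assms
proof (induction n arbitrary: a)
  case 0
  then show ?case by simp
next
  case (Suc n)
  have sym: "a i n = a n i" if "i < n" for i using Suc.prems(1)[of n i] that by simp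
  define e where "e = a n n"
  have e: "e > 0"
    using Suc.prems(2)[of "\<lambda>i. of_bool (i = n)"] by (simp add: e_def)
  define s where "s i j = a i j - a n i * a n j / e" for i j
  have "\<exists>c. (\<forall>i<n. c i i > 0) \<and> (\<forall>i<n. \<forall>k<i. c i k = 0) \<and>
    (\<forall>i<n. \<forall>j<n. s i j = (\<Sum>k<n. c i k * c j k))"
  proof (rule Suc.IH)
    show "s j i = s i j" if "i < n" "j < n" for i j
      using Suc.prems(1)[of i j] that by (simp add: s_def)
  next
    fix x :: "nat \<Rightarrow> real" assume x: "\<exists>i<n. x i \<noteq> 0"
    \<comment> \<open>the last entry minimizes the full form for the given first \<open>n\<close> entries\<close>
    define b where "b = (\<Sum>i<n. a n i * x i)"
    define y where "y = x(n := - b / e)"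
    have y: "y i = x i" if "i < n" for i using that by (simp add: y_def)
    have yn: "y n = - b / e" by (simp add: y_def)
    have "(\<Sum>i<Suc n. \<Sum>j<Suc n. a i j * y i * y j) =
        (\<Sum>i<n. (\<Sum>j<n. a i j * x i * x j) + a i n * x i * y n) +
        ((\<Sum>j<n. a n j * y n * x j) + e * y n * y n)"
      by (simp add: y e_def)
    also have "(\<Sum>i<n. (\<Sum>j<n. a i j * x i * x j) + a i n * x i * y n) =
        (\<Sum>i<n. \<Sum>j<n. a i j * x i * x j) + (\<Sum>i<n. a i n * x i) * y n"
      by (simp only: sum.distrib sum_distrib_right)
    also have "(\<Sum>j<n. a n j * y n * x j) = b * y n"
      by (simp add: b_def sum_distrib_left sum_distrib_right mult_ac)
    also have "(\<Sum>i<n. a i n * x i) = b" unfolding b_def by (intro sum.cong) (auto simp: sym)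
    also have "(\<Sum>i<n. \<Sum>j<n. a i j * x i * x j) + b * y n + (b * y n + e * y n * y n) =
        (\<Sum>i<n. \<Sum>j<n. a i j * x i * x j) - b * b / e"
      using e by (simp add: yn field_simps)
    also have "\<dots> = (\<Sum>i<n. \<Sum>j<n. s i j * x i * x j)"
    proof -
      have "b * b / e = (\<Sum>i<n. \<Sum>j<n. a n i * a n j / e * x i * x j)"
        by (simp add: b_def sum_product sum_divide_distrib mult_ac)
      then show ?thesis by (simp add: s_def sum_subtractf left_diff_distrib)
    qed
    finally have "(\<Sum>i<Suc n. \<Sum>j<Suc n. a i j * y i * y j) = (\<Sum>i<n. \<Sum>j<n. s i j * x i * x j)" .
    moreover have "\<exists>i<Suc n. y i \<noteq> 0"
      using x unfolding y_def by (metis fun_upd_apply less_SucI less_irrefl)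
    ultimately show "(\<Sum>i<n. \<Sum>j<n. s i j * x i * x j) > 0" using Suc.prems(2)[of y] by simp
  qed
  then obtain c where c: "\<And>i. i < n \<Longrightarrow> c i i > 0" "\<And>i k. i < n \<Longrightarrow> k < i \<Longrightarrow> c i k = 0"
    "\<And>i j. i < n \<Longrightarrow> j < n \<Longrightarrow> s i j = (\<Sum>k<n. c i k * c j k)" by blast
  define c' where "c' i k = (if k = n then (if i = n then sqrt e else a n i / sqrt e)
      else if i = n then 0 else c i k)" for i k
  have se: "sqrt e * sqrt e = e" "sqrt e > 0" using e by simp_all
  show ?case
  proof (intro exI[of _ c'] conjI allI impI)
    fix i assume "i < Suc n"
    then show "c' i i > 0" using c(1) se by (auto simp: c'_def less_Suc_eq)
  next
    fix i k assume "i < Suc n" "k < i"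
    then show "c' i k = 0" using c(2) by (auto simp: c'_def less_Suc_eq)
  next
    fix i j assume "i < Suc n" "j < Suc n"
    then consider "i < n" "j < n" | "i < n" "j = n" | "i = n" "j < n" | "i = n" "j = n"
      by (auto simp: less_Suc_eq)
    then show "a i j = (\<Sum>k<Suc n. c' i k * c' j k)"
    proof cases
      case 1
      then have "(\<Sum>k<n. c' i k * c' j k) = (\<Sum>k<n. c i k * c j k)"
        by (intro sum.cong) (auto simp: c'_def)
      also have "\<dots> = s i j" using c(3) 1 by simp
      finally show ?thesis using 1 se by (simp add: c'_def s_def)
    qed (use se sym in \<open>auto simp: c'_def e_def\<close>)
  qed
qed

lemma pos_def_Cholesky:
  assumes "pos_def n A"
  obtains C where "C \<in> carrier_mat n n" "upper_triangular C" "\<forall>i<n. C $$ (i, i) > 0"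
    "A = C * transpose_mat C"
proof -
  have A: "A \<in> carrier_mat n n" "transpose_mat A = A"
    and pos: "\<And>x. x \<in> carrier_vec n \<Longrightarrow> x \<noteq> 0\<^sub>v n \<Longrightarrow> x \<bullet> (A *\<^sub>v x) > 0"
    using assms by (auto simp: pos_def_def)
  have "\<exists>c. (\<forall>i<n. c i i > 0) \<and> (\<forall>i<n. \<forall>k<i. c i k = 0) \<and>
    (\<forall>i<n. \<forall>j<n. A $$ (i, j) = (\<Sum>k<n. c i k * c j k))"
  proof (rule pos_def_Cholesky_sums)
    fix x :: "nat \<Rightarrow> real" assume "\<exists>i<n. x i \<noteq> 0"
    then obtain i where "i < n" "vec n x $ i \<noteq> 0\<^sub>v n $ i" by auto
    then have "vec n x \<noteq> 0\<^sub>v n" by metis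
    then show "(\<Sum>i<n. \<Sum>j<n. A $$ (i, j) * x i * x j) > 0"
      using pos[of "vec n x"] quadratic_form_sum[OF A(1), of "vec n x"] by simp
  qed (rule symmetric_matD[OF A])
  then obtain c where c: "\<forall>i<n. c i i > 0" "\<forall>i<n. \<forall>k<i. c i k = 0"
    "\<forall>i<n. \<forall>j<n. A $$ (i, j) = (\<Sum>k<n. c i k * c j k)" by (elim exE conjE)
  show ?thesis
  proof (rule that[of "mat n n (\<lambda>(i, j). c i j)"])
    show "A = mat n n (\<lambda>(i, j). c i j) * transpose_mat (mat n n (\<lambda>(i, j). c i j))"
      using A c(3) by (intro eq_matI) (auto simp: scalar_prod_def atLeast0LessThan)
  qed (use c in auto)
qed

lemma det_upper_triangular_prod:
  fixes C :: "'a :: comm_ring_1 mat"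
  assumes "C \<in> carrier_mat n n" "upper_triangular C"
  shows "det C = (\<Prod>i<n. C $$ (i, i))"
  using det_upper_triangular[OF assms(2,1)] assms(1)
  by (simp add: prod_list_diag_prod atLeast0LessThan)

lemma pos_def_det_pos:
  assumes "pos_def n A"
  shows "det A > 0"
proof -
  obtain C where C: "C \<in> carrier_mat n n" "upper_triangular C" "\<forall>i<n. C $$ (i, i) > 0"
    "A = C * transpose_mat C" by (rule pos_def_Cholesky[OF assms]) 
  have "det C > 0" unfolding det_upper_triangular_prod[OF C(1,2)] using C(3) by (auto intro!: prod_pos)
  then show ?thesis unfolding C(4) using C(1) by (simp add: det_mult[of _ n] det_transpose[of _ n])
qed

text \<open>
  The trace of \<open>A * B\<close> when \<open>B\<close> is symmetric, i.e. the Frobenius inner product.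
\<close>

definition trace_prod :: "nat \<Rightarrow> real mat \<Rightarrow> real mat \<Rightarrow> real" where
  "trace_prod n A B = (\<Sum>i<n. \<Sum>j<n. A $$ (i, j) * B $$ (i, j))"

text \<open>
  With \<open>A = C C\<^sup>T\<close> and \<open>C\<close> triangular, the determinant is the product of the squares of the diagonal
  entries of \<open>C\<close>, while the trace is the sum of the squares of all its entries.
\<close>

lemma pos_def_ln_det_le_trace:
  assumes "pos_def n A"
  shows "real n + ln (det A) \<le> (\<Sum>i<n. A $$ (i, i))"
proof -
  obtain C where C: "C \<in> carrier_mat n n" "upper_triangular C" "\<forall>i<n. C $$ (i, i) > 0"
    "A = C * transpose_mat C" by (rule pos_def_Cholesky[OF assms])
  have "det A = (\<Prod>i<n. (C $$ (i, i))\<^sup>2)"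
    unfolding C(4) using C(1) det_upper_triangular_prod[OF C(1,2)]
    by (simp add: det_mult[of _ n] det_transpose[of _ n] prod.distrib power2_eq_square)
  also have "ln \<dots> = (\<Sum>i<n. ln ((C $$ (i, i))\<^sup>2))"
    using C(3) by (intro ln_prod) auto
  finally have "real n + ln (det A) = (\<Sum>i<n. 1 + ln ((C $$ (i, i))\<^sup>2))"
    by (simp add: sum.distrib)
  also have "\<dots> \<le> (\<Sum>i<n. A $$ (i, i))"
  proof (rule sum_mono)
    fix i assume "i \<in> {..<n}"
    then have i: "i < n" by simp
    have "1 + ln ((C $$ (i, i))\<^sup>2) \<le> (C $$ (i, i))\<^sup>2"
      using ln_le_minus_one[of "(C $$ (i, i))\<^sup>2"] C(3) i by force
    also have "\<dots> \<le> (\<Sum>k<n. (C $$ (i, k))\<^sup>2)"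
      using i by (intro member_le_sum) auto
    also have "\<dots> = A $$ (i, i)"
      using C(1) i by (simp add: C(4) scalar_prod_def atLeast0LessThan power2_eq_square)
    finally show "1 + ln ((C $$ (i, i))\<^sup>2) \<le> A $$ (i, i)" .
  qed
  finally show ?thesis .
qed

lemma pos_def_congruence:
  assumes "pos_def n A" "C \<in> carrier_mat n n" "det C \<noteq> 0"
  shows "pos_def n (transpose_mat C * A * C)"
  unfolding pos_def_def
proof (intro conjI ballI impI)
  have A: "A \<in> carrier_mat n n" "transpose_mat A = A"
    and pos: "\<And>x. x \<in> carrier_vec n \<Longrightarrow> x \<noteq> 0\<^sub>v n \<Longrightarrow> x \<bullet> (A *\<^sub>v x) > 0"
    using assms(1) by (auto simp: pos_def_def)
  note C = assms(2)
  show "transpose_mat C * A * C \<in> carrier_mat n n" using A C by simp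
  have "transpose_mat (transpose_mat C * A * C) = transpose_mat C * transpose_mat (transpose_mat C * A)"
    using A C by (subst transpose_mult[of _ n n _ n]) auto
  also have "transpose_mat (transpose_mat C * A) = A * C"
    using A C by (subst transpose_mult[of _ n n _ n]) auto
  finally show "transpose_mat (transpose_mat C * A * C) = transpose_mat C * A * C"
    using A C by (simp add: assoc_mult_mat[of _ n n _ n _ n])
  fix x :: "real vec" assume x: "x \<in> carrier_vec n" "x \<noteq> 0\<^sub>v n"
  have Cx: "C *\<^sub>v x \<in> carrier_vec n" "C *\<^sub>v x \<noteq> 0\<^sub>v n"
    using C x assms(3) det_0_iff_vec_prod_zero[OF C] by auto
  have "(transpose_mat C * A * C) *\<^sub>v x = transpose_mat C *\<^sub>v (A *\<^sub>v (C *\<^sub>v x))"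
    using A C x by (simp add: assoc_mult_mat_vec[of _ n n _ n])
  moreover have w: "A *\<^sub>v (C *\<^sub>v x) \<in> carrier_vec n" using A Cx by simp
  ultimately have "x \<bullet> ((transpose_mat C * A * C) *\<^sub>v x) = (transpose_mat C *\<^sub>v (A *\<^sub>v (C *\<^sub>v x))) \<bullet> x"
    using C x by (simp add: comm_scalar_prod[of x n])
  also have "\<dots> = (A *\<^sub>v (C *\<^sub>v x)) \<bullet> (C *\<^sub>v x)"
    by (rule transpose_vec_mult_scalar[OF C x(1) w])
  also have "\<dots> = (C *\<^sub>v x) \<bullet> (A *\<^sub>v (C *\<^sub>v x))"
    by (rule comm_scalar_prod[OF w Cx(1)])
  finally show "0 < x \<bullet> ((transpose_mat C * A * C) *\<^sub>v x)" using pos Cx by simp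
qed

lemma pos_def_gram:
  assumes "C \<in> carrier_mat n n" "det C \<noteq> 0"
  shows "pos_def n (C * transpose_mat C)"
proof -
  have "pos_def n (1\<^sub>m n)"
    unfolding pos_def_def
  proof (intro conjI ballI impI)
    fix x :: "real vec" assume x: "x \<in> carrier_vec n" "x \<noteq> 0\<^sub>v n"
    then obtain i where i: "i < n" "x $ i \<noteq> 0" by (metis carrier_vecD eq_vecI index_zero_vec)
    have "x \<bullet> (1\<^sub>m n *\<^sub>v x) = (\<Sum>j<n. x $ j * x $ j)"
      using x by (simp add: scalar_prod_def atLeast0LessThan)
    also have "\<dots> > 0"
      using i by (intro sum_pos2[of _ i]) (auto simp: zero_less_mult_iff linorder_neq_iff)
    finally show "x \<bullet> (1\<^sub>m n *\<^sub>v x) > 0" .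
  qed auto
  from pos_def_congruence[OF this, of "transpose_mat C"] show ?thesis
    using assms by (simp add: det_transpose[of _ n])
qed

lemma trace_prod_gram:
  assumes "C \<in> carrier_mat n n" "L \<in> carrier_mat n n"
  shows "trace_prod n (C * transpose_mat C) L =
    (\<Sum>k<n. \<Sum>i<n. \<Sum>j<n. L $$ (i, j) * C $$ (i, k) * C $$ (j, k))"
proof -
  have "trace_prod n (C * transpose_mat C) L =
      (\<Sum>i<n. \<Sum>j<n. \<Sum>k<n. L $$ (i, j) * C $$ (i, k) * C $$ (j, k))"
    using assms by (auto simp: trace_prod_def scalar_prod_def atLeast0LessThan
        sum_distrib_right sum_distrib_left mult_ac intro!: sum.cong)
  also have "\<dots> = (\<Sum>i<n. \<Sum>k<n. \<Sum>j<n. L $$ (i, j) * C $$ (i, k) * C $$ (j, k))"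
    by (intro sum.cong refl sum.swap)
  also have "\<dots> = (\<Sum>k<n. \<Sum>i<n. \<Sum>j<n. L $$ (i, j) * C $$ (i, k) * C $$ (j, k))"
    by (rule sum.swap)
  finally show ?thesis .
qed

text \<open>
  For \<open>S = C C\<^sup>T\<close>, the matrix \<open>C\<^sup>T L C\<close> is positive definite, has the trace of \<open>S L\<close> and
  the determinant \<open>det S * det L\<close>.
\<close>

lemma log_det_lower_bound:
  assumes S: "pos_def n S" and L: "pos_def n L"
  shows "real n + ln (det L) \<le> trace_prod n S L - ln (det S)"
proof -
  obtain C where C: "C \<in> carrier_mat n n" "upper_triangular C" "\<forall>i<n. C $$ (i, i) > 0"
    "S = C * transpose_mat C" by (rule pos_def_Cholesky[OF S])
  have Lc: "L \<in> carrier_mat n n" using L by (simp add: pos_def_def)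
  have dC: "det C \<noteq> 0"
    using pos_def_det_pos[OF S] C(1) by (auto simp: C(4) det_mult[of _ n] det_transpose[of _ n])
  let ?M = "transpose_mat C * L * C"
  have "det ?M = det S * det L"
    using C(1) Lc by (simp add: C(4) det_mult[of _ n] det_transpose[of _ n])
  then have "ln (det ?M) = ln (det S) + ln (det L)"
    using pos_def_det_pos[OF S] pos_def_det_pos[OF L] by (simp add: ln_mult)
  moreover have "(\<Sum>k<n. ?M $$ (k, k)) = trace_prod n S L"
  proof -
    have "?M $$ (k, k) = (\<Sum>i<n. \<Sum>j<n. L $$ (i, j) * C $$ (i, k) * C $$ (j, k))" if "k < n" for k
      using C(1) Lc that by (auto simp: scalar_prod_def atLeast0LessThan sum_distrib_left
          mult_ac intro!: sum.cong)
    then show ?thesis unfolding C(4) trace_prod_gram[OF C(1) Lc] by simp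
  qed
  ultimately show ?thesis
    using pos_def_ln_det_le_trace[OF pos_def_congruence[OF L C(1) dC]] by simp
qed

text \<open>
  The minimizer is the inverse of \<open>L\<close>, in the factored form \<open>B B\<^sup>T\<close> where \<open>B\<close> is the inverse transpose
  of a Cholesky factor of \<open>L\<close>.
\<close>

lemma log_det_bound_attained:
  assumes L: "pos_def n L"
  obtains S where "pos_def n S" "trace_prod n S L - ln (det S) = real n + ln (det L)"
proof -
  obtain C where C: "C \<in> carrier_mat n n" "upper_triangular C" "\<forall>i<n. C $$ (i, i) > 0"
    "L = C * transpose_mat C" by (rule pos_def_Cholesky[OF L])
  have dC: "det C > 0"
    unfolding det_upper_triangular_prod[OF C(1,2)] using C(3) by (auto intro!: prod_pos)
  define B where "B = transpose_mat ((1 / det C) \<cdot>\<^sub>m adj_mat C)"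
  have B: "B \<in> carrier_mat n n" using adj_mat(1)[OF C(1)] by (simp add: B_def)
  have BC: "transpose_mat B * C = 1\<^sub>m n"
    using adj_mat[OF C(1)] C(1) dC
    by (simp add: B_def mult_smult_assoc_mat[of _ n n _ n]) (intro eq_matI, auto)
  have "det B * det C = 1"
    using arg_cong[OF BC, of det] B C(1) by (simp add: det_mult[of _ n] det_transpose[of _ n])
  then have dB: "det B = 1 / det C" using dC by (simp add: field_simps)
  let ?S = "B * transpose_mat B"
  show ?thesis
  proof (rule that)
    show "pos_def n ?S" using B dB dC by (intro pos_def_gram) auto
    have Lc: "L \<in> carrier_mat n n" using L by (simp add: pos_def_def)
    \<comment> \<open>the trace is the squared Frobenius norm of \<open>transpose_mat B * C\<close>, the identity matrix\<close>
    have "trace_prod n ?S L = (\<Sum>k<n. \<Sum>i<n. \<Sum>j<n. L $$ (i, j) * B $$ (i, k) * B $$ (j, k))"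
      by (rule trace_prod_gram[OF B Lc])
    also have "\<dots> = (\<Sum>k<n. \<Sum>l<n. (\<Sum>i<n. B $$ (i, k) * C $$ (i, l))\<^sup>2)"
    proof (rule sum.cong[OF refl])
      fix k assume "k \<in> {..<n}"
      have "(\<Sum>i<n. \<Sum>j<n. L $$ (i, j) * B $$ (i, k) * B $$ (j, k)) =
          (\<Sum>i<n. \<Sum>j<n. \<Sum>l<n. (B $$ (i, k) * C $$ (i, l)) * (B $$ (j, k) * C $$ (j, l)))"
        using C(1) by (auto simp: C(4) scalar_prod_def atLeast0LessThan sum_distrib_left
            mult_ac intro!: sum.cong)
      also have "\<dots> = (\<Sum>i<n. \<Sum>l<n. \<Sum>j<n. (B $$ (i, k) * C $$ (i, l)) * (B $$ (j, k) * C $$ (j, l)))"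
        by (intro sum.cong refl sum.swap)
      also have "\<dots> = (\<Sum>l<n. \<Sum>i<n. \<Sum>j<n. (B $$ (i, k) * C $$ (i, l)) * (B $$ (j, k) * C $$ (j, l)))"
        by (rule sum.swap)
      also have "\<dots> = (\<Sum>l<n. (\<Sum>i<n. B $$ (i, k) * C $$ (i, l))\<^sup>2)"
        by (simp add: power2_eq_square sum_product)
      finally show "(\<Sum>i<n. \<Sum>j<n. L $$ (i, j) * B $$ (i, k) * B $$ (j, k)) = \<dots>" .
    qed
    also have "\<dots> = (\<Sum>k<n. \<Sum>l<n. if l = k then 1 else 0)"
    proof (intro sum.cong refl)
      fix k l assume "k \<in> {..<n}" "l \<in> {..<n}"
      then have "(\<Sum>i<n. B $$ (i, k) * C $$ (i, l)) = (transpose_mat B * C) $$ (k, l)"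
        using B C(1) by (simp add: scalar_prod_def atLeast0LessThan)
      then show "(\<Sum>i<n. B $$ (i, k) * C $$ (i, l))\<^sup>2 = (if l = k then 1 else 0)"
        using \<open>k \<in> {..<n}\<close> \<open>l \<in> {..<n}\<close> by (simp add: BC)
    qed
    also have "\<dots> = real n" by simp
    finally have "trace_prod n ?S L = real n" .
    moreover have "det ?S = 1 / det L"
      using B C(1) dB by (simp add: C(4) det_mult[of _ n] det_transpose[of _ n])
    then have "ln (det ?S) = - ln (det L)"
      using pos_def_det_pos[OF L] by (simp add: ln_div)
    ultimately show "trace_prod n ?S L - ln (det ?S) = real n + ln (det L)" by simp
  qed
qed

text \<open>
  Take \<open>x\<close> with \<open>x \<bullet> L x \<le> 0\<close> and some \<open>x\<^sub>m \<noteq> 0\<close>, and let \<open>P\<close> be the identity matrix with column \<open>m\<close> replaced by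
  \<open>t x\<close>. For \<open>S = P P\<^sup>T\<close> the trace of \<open>S L\<close> contains \<open>t\<close> only through \<open>t\<^sup>2 (x \<bullet> L x) \<le> 0\<close>, whereas \<open>det S\<close> is
  \<open>(t x\<^sub>m)\<^sup>2\<close>.
\<close>

lemma log_det_unbounded:
  assumes L: "L \<in> carrier_mat n n" "transpose_mat L = L" and not_pos: "\<not> pos_def n L"
  obtains S where "pos_def n S" "trace_prod n S L - ln (det S) < r"
proof -
  obtain x where x: "x \<in> carrier_vec n" "x \<noteq> 0\<^sub>v n" "x \<bullet> (L *\<^sub>v x) \<le> 0"
    using L not_pos by (auto simp: pos_def_def not_less)
  then obtain m where m: "m < n" "x $ m \<noteq> 0" by (metis carrier_vecD eq_vecI index_zero_vec)
  define P where "P t = replace_col (1\<^sub>m n) (1\<^sub>m n *\<^sub>v (t \<cdot>\<^sub>v x)) m" for t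
  have P: "P t \<in> carrier_mat n n" for t by (simp add: P_def replace_col_def)
  have det_P: "det (P t) = t * x $ m" for t
    unfolding P_def using cramer_lemma_mat[of "1\<^sub>m n" n "t \<cdot>\<^sub>v x" m] m x by simp
  have P_entry: "P t $$ (i, k) = (if k = m then t * x $ i else of_bool (i = k))"
    if "i < n" "k < n" for t i k
    using that x by (simp add: P_def replace_col_def)
  define K where "K = (\<Sum>k\<in>{..<n} - {m}. L $$ (k, k))"
  have trace: "trace_prod n (P t * transpose_mat (P t)) L \<le> K" for t
  proof -
    let ?f = "\<lambda>k. \<Sum>i<n. \<Sum>j<n. L $$ (i, j) * P t $$ (i, k) * P t $$ (j, k)"
    have "?f k = L $$ (k, k)" if "k < n" "k \<noteq> m" for k
    proof -
      have "?f k = (\<Sum>i<n. \<Sum>j<n. if j = k then (if i = k then L $$ (i, j) else 0) else 0)"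
        using that by (intro sum.cong) (auto simp: P_entry)
      also have "\<dots> = L $$ (k, k)" using that by (simp add: sum.delta')
      finally show ?thesis .
    qed
    then have "(\<Sum>k<n. ?f k) = ?f m + K"
      using m by (subst sum.remove[of _ m]) (auto simp: K_def)
    moreover have "?f m = t\<^sup>2 * (x \<bullet> (L *\<^sub>v x))"
      using m by (auto simp: quadratic_form_sum[OF L(1) x(1)] P_entry sum_distrib_left
          power2_eq_square mult_ac intro!: sum.cong)
    moreover have "t\<^sup>2 * (x \<bullet> (L *\<^sub>v x)) \<le> 0" using x(3) by (simp add: mult_nonneg_nonpos)
    ultimately show ?thesis by (simp add: trace_prod_gram[OF P L(1)])
  qed
  \<comment> \<open>chosen such that \<open>ln (det S) = K - r + 1\<close>\<close>
  define t where "t = exp ((K - r + 1) / 2) / x $ m"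
  have dt: "det (P t) = exp ((K - r + 1) / 2)" using m by (simp add: det_P t_def)
  show ?thesis
  proof (rule that)
    show "pos_def n (P t * transpose_mat (P t))" using P dt by (intro pos_def_gram) auto
    have "det (P t * transpose_mat (P t)) = exp (K - r + 1)"
      using P[of t] dt by (simp add: det_mult[of _ n] det_transpose[of _ n] exp_add[symmetric])
    then show "trace_prod n (P t * transpose_mat (P t)) L - ln (det (P t * transpose_mat (P t))) < r"
      using trace[of t] by simp
  qed
qed

section \<open>Variograms and Laplacians relative to a root\<close>

text \<open>
  For the variogram of a random vector, the covariances of its increments relative to component \<open>n\<close>.
\<close>

definition farris :: "nat \<Rightarrow> real mat \<Rightarrow> real mat" where
  "farris n \<Gamma> = mat n n (\<lambda>(i, j). (\<Gamma> $$ (i, n) + \<Gamma> $$ (j, n) - \<Gamma> $$ (i, j)) / 2)"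

text \<open>
  The inverse of the Farris transform: \<open>S\<close> is extended by zero to the root \<open>n\<close>.
\<close>

definition variogram :: "nat \<Rightarrow> real mat \<Rightarrow> real mat" where
  "variogram n S = (let s = (\<lambda>i j. if i < n \<and> j < n then S $$ (i, j) else 0)
     in mat (Suc n) (Suc n) (\<lambda>(i, j). s i i + s j j - 2 * s i j))"

lemma sym0D:
  assumes "A \<in> sym0 d"
  shows "A \<in> carrier_mat d d" "transpose_mat A = A"
    "i < d \<Longrightarrow> A $$ (i, i) = 0" "i < d \<Longrightarrow> j < d \<Longrightarrow> A $$ (j, i) = A $$ (i, j)"
  using assms symmetric_matD[of A d i j] by (auto simp: sym0_def)

lemma sym0I:
  assumes "A \<in> carrier_mat d d" "\<And>i. i < d \<Longrightarrow> A $$ (i, i) = 0"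
    "\<And>i j. i < d \<Longrightarrow> j < d \<Longrightarrow> A $$ (j, i) = A $$ (i, j)"
  shows "A \<in> sym0 d"
  using assms by (auto simp: sym0_def intro!: eq_matI)

lemma mem_sum_zero_vecs_iff:
  "x \<in> sum_zero_vecs d \<longleftrightarrow> x \<in> carrier_vec d \<and> (\<Sum>i<d. x $ i) = 0"
  by (auto simp: sum_zero_vecs_def scalar_prod_def atLeast0LessThan)

lemma symmetric_farris:
  assumes "\<Gamma> \<in> sym0 (Suc n)"
  shows "farris n \<Gamma> \<in> carrier_mat n n" "transpose_mat (farris n \<Gamma>) = farris n \<Gamma>"
  using sym0D[OF assms] by (auto simp: farris_def intro!: eq_matI)

text \<open>
  \<open>\<Gamma>\<^sub>i\<^sub>j\<close> differs from \<open>- 2 S\<^sub>i\<^sub>j\<close> by \<open>\<Gamma>\<^sub>i\<^sub>n + \<Gamma>\<^sub>j\<^sub>n\<close>, which depends on one index at a time and so is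
  invisible to vectors with zero sum.
\<close>

lemma quadratic_form_farris:
  assumes \<Gamma>: "\<Gamma> \<in> sym0 (Suc n)" and x: "(\<Sum>i<Suc n. x i) = 0"
  shows "(\<Sum>i<Suc n. \<Sum>j<Suc n. \<Gamma> $$ (i, j) * x i * x j) =
    - 2 * (\<Sum>i<n. \<Sum>j<n. farris n \<Gamma> $$ (i, j) * x i * x j)"
proof -
  define s where "s i j = (\<Gamma> $$ (i, n) + \<Gamma> $$ (j, n) - \<Gamma> $$ (i, j)) / 2" for i j
  have s0: "s i n = 0" "s n i = 0" if "i < Suc n" for i
    using that sym0D[OF \<Gamma>] by (simp_all add: s_def)
  have "(\<Sum>i<Suc n. \<Sum>j<Suc n. \<Gamma> $$ (i, j) * x i * x j) =
      (\<Sum>i<Suc n. \<Sum>j<Suc n. (\<Gamma> $$ (i, n) * x i) * x j + x i * (\<Gamma> $$ (j, n) * x j) -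
        2 * (s i j * x i * x j))"
    by (intro sum.cong refl) (simp add: s_def field_simps)
  also have "\<dots> = (\<Sum>i<Suc n. \<Gamma> $$ (i, n) * x i) * (\<Sum>j<Suc n. x j) +
      (\<Sum>i<Suc n. x i) * (\<Sum>j<Suc n. \<Gamma> $$ (j, n) * x j) -
      2 * (\<Sum>i<Suc n. \<Sum>j<Suc n. s i j * x i * x j)"
    unfolding sum_product by (simp only: sum.distrib sum_subtractf sum_distrib_left)
  also have "\<dots> = - 2 * (\<Sum>i<Suc n. \<Sum>j<Suc n. s i j * x i * x j)"
    unfolding x by simp
  also have "(\<Sum>i<Suc n. \<Sum>j<Suc n. s i j * x i * x j) = (\<Sum>i<n. \<Sum>j<n. s i j * x i * x j)"
    using s0 by simp
  also have "\<dots> = (\<Sum>i<n. \<Sum>j<n. farris n \<Gamma> $$ (i, j) * x i * x j)"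
    by (simp add: s_def farris_def)
  finally show ?thesis .
qed

text \<open>
  Vectors with zero sum are determined by their first \<open>n\<close> entries, which are arbitrary.
\<close>

lemma cnd_cone_iff_farris:
  assumes \<Gamma>: "\<Gamma> \<in> sym0 (Suc n)"
  shows "\<Gamma> \<in> cnd_cone (Suc n) \<longleftrightarrow> pos_def n (farris n \<Gamma>)"
proof -
  note S = symmetric_farris[OF \<Gamma>]
  have form: "x \<bullet> (\<Gamma> *\<^sub>v x) = - 2 * (y \<bullet> (farris n \<Gamma> *\<^sub>v y))"
    if "x \<in> sum_zero_vecs (Suc n)" "y \<in> carrier_vec n" "\<And>i. i < n \<Longrightarrow> y $ i = x $ i" for x y
    using that quadratic_form_farris[OF \<Gamma>, of "\<lambda>i. x $ i"] unfolding mem_sum_zero_vecs_iff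
    by (simp only: quadratic_form_sum[OF sym0D(1)[OF \<Gamma>]] quadratic_form_sum[OF S(1)])
      (auto intro!: sum.cong)
  show ?thesis
  proof
    assume cone: "\<Gamma> \<in> cnd_cone (Suc n)"
    show "pos_def n (farris n \<Gamma>)"
      unfolding pos_def_def
    proof (intro conjI ballI impI S)
      fix y :: "real vec" assume y: "y \<in> carrier_vec n" "y \<noteq> 0\<^sub>v n"
      then obtain m where m: "m < n" "y $ m \<noteq> 0" by (metis carrier_vecD eq_vecI index_zero_vec)
      define x where "x = vec (Suc n) (\<lambda>i. if i < n then y $ i else - (\<Sum>i<n. y $ i))"
      have "x \<in> sum_zero_vecs (Suc n)" by (simp add: mem_sum_zero_vecs_iff x_def)
      moreover have "x $ m \<noteq> 0" using m by (simp add: x_def)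
      then have "x \<noteq> 0\<^sub>v (Suc n)" using m by auto
      ultimately show "y \<bullet> (farris n \<Gamma> *\<^sub>v y) > 0"
        using cone form[of x y] y by (auto simp: cnd_cone_def x_def)
    qed
  next
    assume pd: "pos_def n (farris n \<Gamma>)"
    have "x \<bullet> (\<Gamma> *\<^sub>v x) < 0" if x: "x \<in> sum_zero_vecs (Suc n)" "x \<noteq> 0\<^sub>v (Suc n)" for x
    proof -
      define y where "y = vec n (\<lambda>i. x $ i)"
      have "y \<noteq> 0\<^sub>v n"
      proof
        assume "y = 0\<^sub>v n"
        then have "x $ i = 0" if "i < n" for i using that by (metis index_vec index_zero_vec(1) y_def)
        moreover from this have "x $ n = 0" using x(1) by (simp add: mem_sum_zero_vecs_iff)
        ultimately have "x = 0\<^sub>v (Suc n)"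
          using x(1) by (intro eq_vecI) (auto simp: mem_sum_zero_vecs_iff less_Suc_eq)
        then show False using x(2) by simp
      qed
      then show ?thesis using pd form[of x y] x by (auto simp: pos_def_def y_def)
    qed
    then show "\<Gamma> \<in> cnd_cone (Suc n)" using \<Gamma> by (simp add: cnd_cone_def)
  qed
qed

lemma variogram_in_sym0:
  assumes "S \<in> carrier_mat n n" "transpose_mat S = S"
  shows "variogram n S \<in> sym0 (Suc n)"
  using symmetric_matD[OF assms] by (intro sym0I) (auto simp: variogram_def Let_def)

lemma farris_variogram:
  assumes "S \<in> carrier_mat n n" "transpose_mat S = S"
  shows "farris n (variogram n S) = S"
  using assms by (intro eq_matI) (auto simp: farris_def variogram_def Let_def)

lemma Theta_row_sum:
  assumes Q: "Q \<in> sym0 d" and i: "i < d"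
  shows "(\<Sum>j<d. Theta d Q $$ (i, j)) = 0"
proof -
  have "(\<Sum>j<d. Theta d Q $$ (i, j)) = Theta d Q $$ (i, i) + (\<Sum>j\<in>{..<d} - {i}. Theta d Q $$ (i, j))"
    using i by (intro sum.remove) auto
  also have "(\<Sum>j\<in>{..<d} - {i}. Theta d Q $$ (i, j)) = - (\<Sum>j\<in>{..<d} - {i}. Q $$ (i, j))"
    unfolding sum_negf[symmetric] using i by (intro sum.cong) (auto simp: Theta_def)
  finally show ?thesis using i by (simp add: Theta_def atLeast0LessThan)
qed

lemma Theta_sym:
  assumes Q: "Q \<in> sym0 d" and "i < d" "j < d"
  shows "Theta d Q $$ (j, i) = Theta d Q $$ (i, j)"
  using assms sym0D(4)[OF Q] by (auto simp: Theta_def)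

lemma symmetric_reduced_laplacian:
  assumes "Q \<in> sym0 (Suc n)"
  shows "reduced_laplacian n Q \<in> carrier_mat n n"
    "transpose_mat (reduced_laplacian n Q) = reduced_laplacian n Q"
  using Theta_sym[OF assms] by (auto simp: reduced_laplacian_def intro!: eq_matI)

lemma Theta_weighted_sums_zero:
  assumes Q: "Q \<in> sym0 d"
  shows "(\<Sum>i<d. \<Sum>j<d. Theta d Q $$ (i, j) * a i) = 0"
    "(\<Sum>i<d. \<Sum>j<d. Theta d Q $$ (i, j) * a j) = 0"
proof -
  show 1: "(\<Sum>i<d. \<Sum>j<d. Theta d Q $$ (i, j) * a i) = 0"
    using Theta_row_sum[OF Q] by (simp add: sum_distrib_right[symmetric])
  have "(\<Sum>i<d. \<Sum>j<d. Theta d Q $$ (i, j) * a j) = (\<Sum>j<d. \<Sum>i<d. Theta d Q $$ (i, j) * a j)"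
    by (rule sum.swap)
  also have "\<dots> = (\<Sum>j<d. \<Sum>i<d. Theta d Q $$ (j, i) * a j)"
    using Theta_sym[OF Q] by (intro sum.cong) auto
  finally show "(\<Sum>i<d. \<Sum>j<d. Theta d Q $$ (i, j) * a j) = 0" using 1 by simp
qed

text \<open>
  The rows and columns of \<open>\<Theta>\<close> sum to zero, so the form does not change when \<open>x\<close> is shifted by a constant;
  the shift chosen here makes the root entry vanish.
\<close>

lemma quadratic_form_reduced_laplacian:
  assumes Q: "Q \<in> sym0 (Suc n)"
  shows "(\<Sum>i<Suc n. \<Sum>j<Suc n. Theta (Suc n) Q $$ (i, j) * x i * x j) =
    (\<Sum>i<n. \<Sum>j<n. reduced_laplacian n Q $$ (i, j) * (x i - x n) * (x j - x n))"
proof -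
  let ?t = "\<lambda>i j. Theta (Suc n) Q $$ (i, j)"
  have "(\<Sum>i<Suc n. \<Sum>j<Suc n. ?t i j * x i * x j) =
      (\<Sum>i<Suc n. \<Sum>j<Suc n. ?t i j * (x i - x n) * (x j - x n) + ?t i j * (x i * x n) +
        ?t i j * ((x j - x n) * x n))"
    by (intro sum.cong refl) (simp add: algebra_simps)
  also have "\<dots> = (\<Sum>i<Suc n. \<Sum>j<Suc n. ?t i j * (x i - x n) * (x j - x n))"
    by (simp only: sum.distrib Theta_weighted_sums_zero[OF Q] add_0_right)
  also have "\<dots> = (\<Sum>i<n. \<Sum>j<n. reduced_laplacian n Q $$ (i, j) * (x i - x n) * (x j - x n))"
    by (simp add: reduced_laplacian_def)
  finally show ?thesis .
qed

text \<open>
  The differences \<open>x\<^sub>i - x\<^sub>n\<close> identify the vectors with zero sum with all vectors of length \<open>n\<close>; conversely,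
  a vector extended by \<open>0\<close> at the root is shifted by its mean.
\<close>

lemma Q_space_iff_reduced_laplacian:
  assumes Q: "Q \<in> sym0 (Suc n)"
  shows "Q \<in> Q_space (Suc n) \<longleftrightarrow> pos_def n (reduced_laplacian n Q)"
proof -
  note L = symmetric_reduced_laplacian[OF Q]
  have Th: "Theta (Suc n) Q \<in> carrier_mat (Suc n) (Suc n)" by (simp add: Theta_def)
  have form: "x \<bullet> (Theta (Suc n) Q *\<^sub>v x) = y \<bullet> (reduced_laplacian n Q *\<^sub>v y)"
    if "x \<in> carrier_vec (Suc n)" "y \<in> carrier_vec n" "\<And>i. i < n \<Longrightarrow> y $ i = x $ i - x $ n" for x y
    using quadratic_form_reduced_laplacian[OF Q, of "\<lambda>i. x $ i"] that(3)
    by (simp only: quadratic_form_sum[OF Th that(1)] quadratic_form_sum[OF L(1) that(2)])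
      (auto intro!: sum.cong)
  show ?thesis
  proof
    assume QQ: "Q \<in> Q_space (Suc n)"
    show "pos_def n (reduced_laplacian n Q)"
      unfolding pos_def_def
    proof (intro conjI ballI impI L)
      fix y :: "real vec" assume y: "y \<in> carrier_vec n" "y \<noteq> 0\<^sub>v n"
      then obtain k where k: "k < n" "y $ k \<noteq> 0" by (metis carrier_vecD eq_vecI index_zero_vec)
      \<comment> \<open>the mean of \<open>y\<close> extended by \<open>0\<close> at the root, hence the divisor \<open>n + 1\<close>\<close>
      define m where "m = (\<Sum>i<n. y $ i) / real (Suc n)"
      define x where "x = vec (Suc n) (\<lambda>i. if i < n then y $ i - m else - m)"
      have "(\<Sum>i<Suc n. x $ i) = (\<Sum>i<n. y $ i) - real (Suc n) * m"
        by (simp add: x_def sum_subtractf algebra_simps)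
      also have "\<dots> = 0" by (simp add: m_def)
      finally have "x \<in> sum_zero_vecs (Suc n)" by (simp add: mem_sum_zero_vecs_iff x_def)
      moreover have "x $ k \<noteq> x $ n" using k by (simp add: x_def)
      then have "x \<noteq> 0\<^sub>v (Suc n)" using k by auto
      ultimately show "y \<bullet> (reduced_laplacian n Q *\<^sub>v y) > 0"
        using QQ form[of x y] y by (auto simp: Q_space_def x_def)
    qed
  next
    assume pd: "pos_def n (reduced_laplacian n Q)"
    have "x \<bullet> (Theta (Suc n) Q *\<^sub>v x) > 0" if x: "x \<in> sum_zero_vecs (Suc n)" "x \<noteq> 0\<^sub>v (Suc n)" for x
    proof -
      define y where "y = vec n (\<lambda>i. x $ i - x $ n)"
      have "y \<noteq> 0\<^sub>v n"
      proof
        assume "y = 0\<^sub>v n"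
        then have "x $ i - x $ n = 0" if "i < n" for i
          using that by (metis index_vec index_zero_vec(1) y_def)
        then have eq: "x $ i = x $ n" if "i < Suc n" for i using that by (auto simp: less_Suc_eq)
        have "(\<Sum>i<Suc n. x $ i) = (\<Sum>i<Suc n. x $ n)"
          by (intro sum.cong refl eq) (simp only: lessThan_iff)
        then have "real (Suc n) * x $ n = 0"
          using x(1) by (simp only: mem_sum_zero_vecs_iff sum_constant card_lessThan)
        then have xn: "x $ n = 0" by (metis mult_eq_0_iff of_nat_eq_0_iff nat.distinct(1))
        have "x = 0\<^sub>v (Suc n)"
        proof
          fix i assume "i < dim_vec (0\<^sub>v (Suc n) :: real vec)"
          then have "i < Suc n" by simp
          then show "x $ i = 0\<^sub>v (Suc n) $ i" using eq[of i] xn by simp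
        qed (use x(1) in \<open>simp add: mem_sum_zero_vecs_iff\<close>)
        then show False using x(2) by simp
      qed
      then show ?thesis
        using pd form[of x y] x by (auto simp: pos_def_def y_def mem_sum_zero_vecs_iff)
    qed
    then show "Q \<in> Q_space (Suc n)" using Q by (simp add: Q_space_def)
  qed
qed

lemma finite_edges: "finite (edges d)"
  by (rule finite_subset[of _ "{..<d} \<times> {..<d}"]) (auto simp: edges_def)

lemma sum_edges_Suc: "sum F (edges (Suc d)) = sum F (edges d) + (\<Sum>i<d. F (i, d))"
proof -
  have "edges (Suc d) = edges d \<union> (\<lambda>i. (i, d)) ` {..<d}" by (auto simp: edges_def less_Suc_eq)
  moreover have "edges d \<inter> (\<lambda>i. (i, d)) ` {..<d} = {}" by (auto simp: edges_def)
  ultimately show ?thesis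
    by (simp add: sum.union_disjoint finite_edges sum.reindex inj_on_def)
qed

lemma sum_edges_symmetric:
  fixes F :: "nat \<times> nat \<Rightarrow> real"
  assumes "\<And>i j. i < d \<Longrightarrow> j < d \<Longrightarrow> F (j, i) = F (i, j)" "\<And>i. i < d \<Longrightarrow> F (i, i) = 0"
  shows "(\<Sum>i<d. \<Sum>j<d. F (i, j)) = 2 * sum F (edges d)"
  using assms
proof (induction d)
  case 0
  then show ?case by (simp add: edges_def)
next
  case (Suc d)
  have "(\<Sum>j<d. F (d, j)) = (\<Sum>j<d. F (j, d))" using Suc.prems(1) by (intro sum.cong) auto
  then show ?case using Suc by (simp add: sum_edges_Suc sum.distrib)
qed

text \<open>
  Substituting \<open>\<Gamma>\<^sub>i\<^sub>j = \<Gamma>\<^sub>i\<^sub>n + \<Gamma>\<^sub>j\<^sub>n - 2 S\<^sub>i\<^sub>j\<close> into twice the inner product, the first two terms cancel because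
  the rows and columns of \<open>\<Theta>\<close> sum to zero.
\<close>

lemma inner0_eq_trace_prod:
  assumes \<Gamma>: "\<Gamma> \<in> sym0 (Suc n)" and Q: "Q \<in> sym0 (Suc n)"
  shows "inner0 (Suc n) \<Gamma> Q = trace_prod n (farris n \<Gamma>) (reduced_laplacian n Q)"
proof -
  let ?t = "\<lambda>i j. Theta (Suc n) Q $$ (i, j)"
  define s where "s i j = (\<Gamma> $$ (i, n) + \<Gamma> $$ (j, n) - \<Gamma> $$ (i, j)) / 2" for i j
  have s0: "s i n = 0" "s n i = 0" if "i < Suc n" for i
    using that sym0D[OF \<Gamma>] by (simp_all add: s_def)
  have "2 * inner0 (Suc n) \<Gamma> Q = (\<Sum>i<Suc n. \<Sum>j<Suc n. \<Gamma> $$ (i, j) * Q $$ (i, j))"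
    unfolding inner0_def using sym0D[OF \<Gamma>] sym0D[OF Q]
    by (subst sum_edges_symmetric[symmetric]) auto
  also have "\<dots> = (\<Sum>i<Suc n. \<Sum>j<Suc n. 2 * (s i j * ?t i j) - ?t i j * \<Gamma> $$ (i, n) - ?t i j * \<Gamma> $$ (j, n))"
  proof (intro sum.cong refl)
    fix i j assume "i \<in> {..<Suc n}" "j \<in> {..<Suc n}"
    then have "\<Gamma> $$ (i, j) * Q $$ (i, j) = - \<Gamma> $$ (i, j) * ?t i j"
      using sym0D(3)[OF \<Gamma>, of i] by (cases "i = j") (auto simp: Theta_def)
    then show "\<Gamma> $$ (i, j) * Q $$ (i, j) = 2 * (s i j * ?t i j) - ?t i j * \<Gamma> $$ (i, n) - ?t i j * \<Gamma> $$ (j, n)"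
      by (simp add: s_def field_simps)
  qed
  also have "\<dots> = 2 * (\<Sum>i<Suc n. \<Sum>j<Suc n. s i j * ?t i j)"
    unfolding sum_subtractf Theta_weighted_sums_zero[OF Q] by (simp only: sum_distrib_left diff_0_right)
  also have "(\<Sum>i<Suc n. \<Sum>j<Suc n. s i j * ?t i j) = (\<Sum>i<n. \<Sum>j<n. s i j * ?t i j)"
    using s0 by simp
  also have "\<dots> = trace_prod n (farris n \<Gamma>) (reduced_laplacian n Q)"
    by (simp add: trace_prod_def farris_def reduced_laplacian_def s_def)
  finally show ?thesis by simp
qed

text \<open>
  Group the root with the last index of the Cayley-Menger matrix. The resulting \<open>2 \<times> 2\<close> block \<open>D\<close> has
  determinant \<open>1\<close>, whatever \<open>\<Gamma>\<close> is, and its Schur complement is exactly the Farris transform.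
\<close>

lemma det_CM_eq_det_farris:
  assumes \<Gamma>: "\<Gamma> \<in> sym0 (Suc n)"
  shows "det (CM (Suc n) \<Gamma>) = det (farris n \<Gamma>)"
proof -
  let ?S = "farris n \<Gamma>"
  let ?B = "mat n 2 (\<lambda>(i, j). if j = 0 then - \<Gamma> $$ (i, n) / 2 else 1)"
  let ?D = "mat 2 2 (\<lambda>(i, j). if i = j then 0 else if i = 0 then 1 else - 1) :: real mat"
  let ?C = "mat 2 n (\<lambda>(i, j). if i = 0 then 1 else - \<Gamma> $$ (n, j) / 2)"
  have S: "?S \<in> carrier_mat n n" by (simp add: farris_def)
  have BC: "?S * 1\<^sub>m n + ?B * ?C = mat n n (\<lambda>(i, j). - \<Gamma> $$ (i, j) / 2)"
    using sym0D[OF \<Gamma>]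
    by (intro eq_matI) (auto simp: farris_def scalar_prod_def numeral_2_eq_2 field_simps)
  have DC: "0\<^sub>m 2 n * 1\<^sub>m n + ?D * ?C = mat 2 n (\<lambda>(i, j). if i = 0 then - \<Gamma> $$ (n, j) / 2 else - 1)"
    by (intro eq_matI) (auto simp: scalar_prod_def numeral_2_eq_2 less_Suc_eq)
  have prod: "four_block_mat ?S ?B (0\<^sub>m 2 n) ?D * four_block_mat (1\<^sub>m n) (0\<^sub>m n 2) ?C (1\<^sub>m 2) =
      four_block_mat (?S * 1\<^sub>m n + ?B * ?C) (?S * 0\<^sub>m n 2 + ?B * 1\<^sub>m 2)
        (0\<^sub>m 2 n * 1\<^sub>m n + ?D * ?C) (0\<^sub>m 2 n * 0\<^sub>m n 2 + ?D * 1\<^sub>m 2)"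
    by (rule mult_four_block_mat[of _ n n _ 2 _ 2]) (use S in auto)
  have B: "?S * 0\<^sub>m n 2 + ?B * 1\<^sub>m 2 = ?B" using S by simp
  have D: "0\<^sub>m 2 n * 0\<^sub>m n 2 + ?D * 1\<^sub>m 2 = ?D" by simp
  let ?X = "four_block_mat ?S ?B (0\<^sub>m 2 n) ?D"
  let ?Y = "four_block_mat (1\<^sub>m n) (0\<^sub>m n 2) ?C (1\<^sub>m 2)"
  have X: "?X \<in> carrier_mat (n + 2) (n + 2)" using S by (intro four_block_carrier_mat) auto
  have Y: "?Y \<in> carrier_mat (n + 2) (n + 2)" by (intro four_block_carrier_mat) auto
  have CM: "CM (Suc n) \<Gamma> = ?X * ?Y"
    unfolding prod BC DC B D
    using sym0D[OF \<Gamma>]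
    by (intro eq_matI) (auto simp: CM_def less_Suc_eq)
  have "det (CM (Suc n) \<Gamma>) = det ?X * det ?Y"
    unfolding CM by (rule det_mult[OF X Y])
  also have "det (four_block_mat ?S ?B (0\<^sub>m 2 n) ?D) = det ?S * det ?D"
    using S by (intro det_four_block_mat_lower_left_zero) auto
  also have "det (four_block_mat (1\<^sub>m n) (0\<^sub>m n 2) ?C (1\<^sub>m 2)) = 1"
    by (subst det_four_block_mat_upper_right_zero[of _ n _ 2]) auto
  also have "det ?D = 1"
    by (subst laplace_expansion_row[of _ 2 0])
      (simp_all add: numeral_2_eq_2 cofactor_def mat_delete_def det_single)
  finally show ?thesis by simp
qed

text \<open>
  The convex conjugate of the log-determinant, carried back from positive definite matrices to
  variograms and edge weights.
\<close>

lemma INF_log_det: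
  assumes Q: "Q \<in> sym0 (Suc n)"
  shows "(INF \<Gamma>\<in>cnd_cone (Suc n). ereal (inner0 (Suc n) \<Gamma> Q - ln (det (CM (Suc n) \<Gamma>)))) =
    (if Q \<in> Q_space (Suc n) then ereal (ln (tree_sum (Suc n) Q) + real n) else - \<infinity>)"
    (is "?inf = _")
proof -
  let ?L = "reduced_laplacian n Q"
  note L = symmetric_reduced_laplacian[OF Q]
  have objective: "inner0 (Suc n) \<Gamma> Q - ln (det (CM (Suc n) \<Gamma>)) =
      trace_prod n (farris n \<Gamma>) ?L - ln (det (farris n \<Gamma>))" if "\<Gamma> \<in> sym0 (Suc n)" for \<Gamma>
    using inner0_eq_trace_prod[OF that Q] det_CM_eq_det_farris[OF that] by simp
  have upper: "?inf \<le> ereal (trace_prod n S ?L - ln (det S))" if S: "pos_def n S" for S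
  proof -
    have sym: "S \<in> carrier_mat n n" "transpose_mat S = S" using S by (auto simp: pos_def_def)
    note V = variogram_in_sym0[OF sym]
    have "variogram n S \<in> cnd_cone (Suc n)"
      using S by (simp add: cnd_cone_iff_farris[OF V] farris_variogram[OF sym])
    then show ?thesis by (rule INF_lower2) (simp add: objective[OF V] farris_variogram[OF sym])
  qed
  show ?thesis
  proof (cases "Q \<in> Q_space (Suc n)")
    case True
    then have pd: "pos_def n ?L" by (simp add: Q_space_iff_reduced_laplacian[OF Q])
    have "?inf \<le> ereal (real n + ln (det ?L))"
      using upper log_det_bound_attained[OF pd] by metis
    moreover have "ereal (real n + ln (det ?L)) \<le> ?inf"
    proof (rule INF_greatest)
      fix \<Gamma> assume \<Gamma>: "\<Gamma> \<in> cnd_cone (Suc n)"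
      then have "\<Gamma> \<in> sym0 (Suc n)" by (simp add: cnd_cone_def)
      then show "ereal (real n + ln (det ?L)) \<le> ereal (inner0 (Suc n) \<Gamma> Q - ln (det (CM (Suc n) \<Gamma>)))"
        using \<Gamma> objective log_det_lower_bound[OF _ pd] by (simp add: cnd_cone_iff_farris)
    qed
    ultimately show ?thesis using True by (simp add: matrix_tree[OF Q] add.commute)
  next
    case False
    then have "\<not> pos_def n ?L" by (simp add: Q_space_iff_reduced_laplacian[OF Q])
    then have "?inf < ereal r" for r
    proof (rule log_det_unbounded[OF L])
      fix S assume "pos_def n S" "trace_prod n S ?L - ln (det S) < r"
      then show "?inf < ereal r" using upper[of S] by (meson ereal_less(2) le_less_trans less_ereal.simps(1))
    qed
    then have "?inf = - \<infinity>" by (metis ereal_bot less_imp_le)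
    then show ?thesis using False by simp
  qed
qed

section \<open>The Lagrangian\<close>

lemma Psi_distinct:
  assumes "(i, j, k) \<in> Psi d E"
  shows "i < d" "j < d" "k < d" "i \<noteq> j" "i \<noteq> k" "j \<noteq> k"
  using assms by (auto simp: Psi_def triangles_def)

lemma grad0_g_entry:
  assumes "(i, j, k) \<in> Psi d E" "a < d" "b < d"
  shows "grad0 d (g (i, j, k)) \<Gamma> $$ (a, b) = (if a = b then 0 else
    of_bool ({i, j} = {a, b}) - of_bool ({i, k} = {a, b}) - of_bool ({j, k} = {a, b}))"
proof -
  note ijk = Psi_distinct[OF assms(1)]
  have entry: "((\<lambda>t. set_coord d \<Gamma> a b t $$ (u, v)) has_field_derivative
      of_bool ({u, v} = {a, b})) (at x)" if "u < d" "v < d" for u v x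
    using that by (cases "{u, v} = {a, b}") (simp_all add: set_coord_def)
  have "deriv (\<lambda>t. g (i, j, k) (set_coord d \<Gamma> a b t)) (\<Gamma> $$ (a, b)) =
      of_bool ({i, j} = {a, b}) - of_bool ({i, k} = {a, b}) - of_bool ({j, k} = {a, b})"
    unfolding g.simps by (intro DERIV_imp_deriv DERIV_diff entry ijk)
  then show ?thesis using assms(2,3) by (simp add: grad0_def)
qed

lemma sum_edges_pair:
  assumes A: "A \<in> sym0 d" and "i < d" "j < d" "i \<noteq> j"
  shows "(\<Sum>(a, b)\<in>edges d. A $$ (a, b) * of_bool ({i, j} = {a, b})) = A $$ (i, j)"
proof -
  have e: "edge i j \<in> edges d" using assms by (simp add: edge_in_edges)
  have "(\<Sum>(a, b)\<in>edges d. A $$ (a, b) * of_bool ({i, j} = {a, b})) =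
      (\<Sum>e\<in>edges d. if e = edge i j then A $$ e else 0)"
    using assms(4) by (intro sum.cong)
      (auto simp: edges_def edge_def doubleton_eq_iff min_def max_def split: if_splits)
  also have "\<dots> = A $$ edge i j" using e finite_edges by (simp add: sum.delta')
  also have "\<dots> = A $$ (i, j)" using sym0D(4)[OF A] assms by (auto simp: edge_def min_def max_def)
  finally show ?thesis .
qed

text \<open>
  Each \<open>g \<psi>\<close> is linear, so its gradient represents it.
\<close>

lemma inner0_grad0_g:
  assumes \<psi>: "\<psi> \<in> Psi d E" and A: "A \<in> sym0 d"
  shows "inner0 d A (grad0 d (g \<psi>) \<Gamma>) = g \<psi> A"
proof -
  obtain i j k where ijk: "\<psi> = (i, j, k)" by (cases \<psi>)
  note d = Psi_distinct[OF \<psi>[unfolded ijk]]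
  have "inner0 d A (grad0 d (g \<psi>) \<Gamma>) =
      (\<Sum>(a, b)\<in>edges d. A $$ (a, b) * of_bool ({i, j} = {a, b}) -
        A $$ (a, b) * of_bool ({i, k} = {a, b}) - A $$ (a, b) * of_bool ({j, k} = {a, b}))"
    unfolding inner0_def ijk using \<psi>
    by (intro sum.cong) (auto simp: edges_def grad0_g_entry ijk algebra_simps)
  also have "\<dots> = g \<psi> A"
    using sum_edges_pair[OF A] d by (simp add: sum_subtractf split_def ijk)
  finally show ?thesis .
qed

lemma Q_eta_in_sym0:
  assumes "Qhat \<in> sym0 d"
  shows "Q_eta d E Qhat \<eta> \<in> sym0 d"
proof (rule sym0I)
  fix i j assume ij: "i < d" "j < d"
  have "grad0 d (g \<psi>) (0\<^sub>m d d) $$ (j, i) = grad0 d (g \<psi>) (0\<^sub>m d d) $$ (i, j)" if "\<psi> \<in> Psi d E" for \<psi>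
    using that ij by (cases \<psi>) (simp add: grad0_g_entry insert_commute)
  then show "Q_eta d E Qhat \<eta> $$ (j, i) = Q_eta d E Qhat \<eta> $$ (i, j)"
    using ij sym0D(4)[OF assms ij] by (simp add: Q_eta_def)
next
  fix i assume i: "i < d"
  have "grad0 d (g \<psi>) (0\<^sub>m d d) $$ (i, i) = 0" for \<psi> using i by (simp add: grad0_def)
  then show "Q_eta d E Qhat \<eta> $$ (i, i) = 0" using i sym0D(3)[OF assms i] by (simp add: Q_eta_def)
qed (simp add: Q_eta_def)

text \<open>
  The multipliers only shift the linear part, so that the dual function is a conjugate evaluated
  at \<open>Q_eta\<close>.
\<close>

lemma lagrangian_eq:
  assumes "\<Gamma> \<in> sym0 d"
  shows "lagrangian d E Qhat \<Gamma> \<eta> = inner0 d \<Gamma> (Q_eta d E Qhat \<eta>) - ln (det (CM d \<Gamma>))"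
proof -
  let ?G = "\<lambda>\<psi>. grad0 d (g \<psi>) (0\<^sub>m d d)"
  have "inner0 d \<Gamma> (Q_eta d E Qhat \<eta>) =
      (\<Sum>e\<in>edges d. \<Gamma> $$ e * Qhat $$ e + (\<Sum>\<psi>\<in>Psi d E. \<eta> \<psi> * (\<Gamma> $$ e * ?G \<psi> $$ e)))"
    unfolding inner0_def
    by (intro sum.cong) (auto simp: edges_def Q_eta_def sum_distrib_left algebra_simps)
  also have "\<dots> = inner0 d \<Gamma> Qhat + (\<Sum>e\<in>edges d. \<Sum>\<psi>\<in>Psi d E. \<eta> \<psi> * (\<Gamma> $$ e * ?G \<psi> $$ e))"
    by (simp add: inner0_def sum.distrib)
  also have "(\<Sum>e\<in>edges d. \<Sum>\<psi>\<in>Psi d E. \<eta> \<psi> * (\<Gamma> $$ e * ?G \<psi> $$ e)) =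
      (\<Sum>\<psi>\<in>Psi d E. \<eta> \<psi> * inner0 d \<Gamma> (?G \<psi>))"
    unfolding inner0_def sum_distrib_left by (rule sum.swap)
  also have "\<dots> = (\<Sum>\<psi>\<in>Psi d E. \<eta> \<psi> * g \<psi> \<Gamma>)"
    using inner0_grad0_g[OF _ assms] by (intro sum.cong) auto
  finally show ?thesis by (simp add: lagrangian_def S2_objective_def)
qed

lemma dual_objective_eq_tree_objective:
  assumes "Qhat \<in> sym0 (Suc n)"
  shows "dual_objective (Suc n) E Qhat \<eta> = tree_objective (Suc n) E Qhat \<eta>"
proof -
  have "dual_objective (Suc n) E Qhat \<eta> = (INF \<Gamma>\<in>cnd_cone (Suc n).
      ereal (inner0 (Suc n) \<Gamma> (Q_eta (Suc n) E Qhat \<eta>) - ln (det (CM (Suc n) \<Gamma>))))"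
    unfolding dual_objective_def by (intro INF_cong) (auto simp: lagrangian_eq cnd_cone_def)
  then show ?thesis
    by (simp add: INF_log_det[OF Q_eta_in_sym0[OF assms]] tree_objective_def)
qed

section \<open>The constraints\<close>

lemma clique_extends:
  assumes "is_complete d E C"
  obtains C' where "C' \<in> cliques d E" "C \<subseteq> C'"
proof -
  let ?A = "{C'. is_complete d E C' \<and> C \<subseteq> C'}"
  have "finite ?A"
    by (rule finite_subset[of _ "Pow {0..<d}"]) (auto simp: is_complete_def)
  moreover have "?A \<noteq> {}" using assms by blast
  ultimately obtain M where M: "M \<in> ?A" "\<forall>C'\<in>?A. M \<subseteq> C' \<longrightarrow> M = C'"
    using finite_has_maximal[of ?A] by metis
  have "C' = M" if "is_complete d E C'" "M \<subseteq> C'" for C'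
    using M that by (metis (mono_tags, lifting) mem_Collect_eq order_trans)
  with M(1) show ?thesis by (intro that[of M]) (simp_all add: cliques_def)
qed

lemma Psi_vertices_complete:
  assumes "E \<subseteq> edges d" "(i, j, k) \<in> Psi d E"
  shows "is_complete d E {i, j, k}"
  using assms by (auto simp: Psi_def triangles_def is_complete_def adjacent_sym)

lemma Psi_of_triangle:
  assumes "i < d" "j < d" "k < d" "i < j" "i \<noteq> k" "j \<noteq> k"
    "adjacent E i j" "adjacent E i k" "adjacent E j k"
  shows "(i, j, k) \<in> Psi d E"
proof -
  consider "j < k" | "i < k" "k < j" | "k < i" using assms by linarith
  then show ?thesis
  proof cases
    case 1
    then have "(i, j, k) \<in> triangles d E" using assms by (auto simp: triangles_def)
    then show ?thesis unfolding Psi_def by fast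
  next
    case 2
    then have "(i, k, j) \<in> triangles d E" using assms by (auto simp: triangles_def adjacent_sym)
    then show ?thesis unfolding Psi_def by fast
  next
    case 3
    then have "(k, i, j) \<in> triangles d E" using assms by (auto simp: triangles_def adjacent_sym)
    then show ?thesis unfolding Psi_def by fast
  qed
qed

text \<open>
  Testing conditional negativity on the difference of two unit vectors. This disposes of the
  triangle inequalities with \<open>i = j\<close>, to which no element of \<open>Psi\<close> corresponds.
\<close>

lemma cnd_cone_nonneg:
  assumes "\<Gamma> \<in> cnd_cone d" "i < d" "j < d"
  shows "\<Gamma> $$ (i, j) \<ge> 0"
proof (cases "i = j")
  case True
  then show ?thesis using assms by (auto simp: cnd_cone_def sym0_def)
next
  case False
  have \<Gamma>: "\<Gamma> \<in> sym0 d" using assms(1) by (simp add: cnd_cone_def)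
  define x where "x = vec d (\<lambda>k. of_bool (k = i) - of_bool (k = j) :: real)"
  have x: "x \<in> carrier_vec d" by (simp add: x_def)
  have "x \<in> sum_zero_vecs d"
    using assms by (simp add: mem_sum_zero_vecs_iff x_def sum_subtractf of_bool_def)
  moreover have "x $ i \<noteq> 0" using False assms by (simp add: x_def)
  then have "x \<noteq> 0\<^sub>v d" using assms by auto
  ultimately have "x \<bullet> (\<Gamma> *\<^sub>v x) < 0" using assms(1) by (simp add: cnd_cone_def)
  also have "x \<bullet> (\<Gamma> *\<^sub>v x) = (\<Sum>a<d. \<Sum>b<d. \<Gamma> $$ (a, b) * x $ a * x $ b)"
    by (rule quadratic_form_sum[OF sym0D(1)[OF \<Gamma>] x])
  also have "\<dots> = (\<Sum>a\<in>{i, j}. \<Sum>b\<in>{i, j}. \<Gamma> $$ (a, b) * x $ a * x $ b)"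
  proof -
    have z: "x $ k = 0" if "k < d" "k \<notin> {i, j}" for k using that by (simp add: x_def)
    have "(\<Sum>b<d. \<Gamma> $$ (a, b) * x $ a * x $ b) = (\<Sum>b\<in>{i, j}. \<Gamma> $$ (a, b) * x $ a * x $ b)" for a
      using assms z by (intro sum.mono_neutral_right) auto
    then show ?thesis
      using assms z by (simp only:) (intro sum.mono_neutral_right, auto)
  qed
  also have "\<dots> = - 2 * \<Gamma> $$ (i, j)"
    using False assms sym0D[OF \<Gamma>] by (simp add: x_def)
  finally show ?thesis by simp
qed

text \<open>
  A triangle lies in some maximal complete set, and any three distinct vertices of a clique form a
  triangle; the symmetry of \<open>\<Gamma>\<close> reduces to \<open>i < j\<close>, and the inequalities with repeated indices hold
  on the whole cone.
\<close>

lemma S2_feasible_eq: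
  assumes E: "E \<subseteq> edges d"
  shows "S2_feasible d E = {\<Gamma> \<in> cnd_cone d. \<forall>\<psi>\<in>Psi d E. g \<psi> \<Gamma> \<le> 0}"
proof (intro equalityI subsetI)
  fix \<Gamma> assume \<Gamma>: "\<Gamma> \<in> S2_feasible d E"
  have "g \<psi> \<Gamma> \<le> 0" if \<psi>: "\<psi> \<in> Psi d E" for \<psi>
  proof -
    obtain i j k where ijk: "\<psi> = (i, j, k)" by (cases \<psi>)
    obtain C where "C \<in> cliques d E" "{i, j, k} \<subseteq> C"
      using clique_extends[OF Psi_vertices_complete[OF E \<psi>[unfolded ijk]]] .
    then have "\<Gamma> $$ (i, j) \<le> \<Gamma> $$ (i, k) + \<Gamma> $$ (j, k)" using \<Gamma> by (simp add: S2_feasible_def)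
    then show ?thesis by (simp add: ijk)
  qed
  then show "\<Gamma> \<in> {\<Gamma> \<in> cnd_cone d. \<forall>\<psi>\<in>Psi d E. g \<psi> \<Gamma> \<le> 0}"
    using \<Gamma> by (simp add: S2_feasible_def)
next
  fix \<Gamma> assume "\<Gamma> \<in> {\<Gamma> \<in> cnd_cone d. \<forall>\<psi>\<in>Psi d E. g \<psi> \<Gamma> \<le> 0}"
  then have cone: "\<Gamma> \<in> cnd_cone d" and le: "\<And>\<psi>. \<psi> \<in> Psi d E \<Longrightarrow> g \<psi> \<Gamma> \<le> 0" by auto
  have sym0: "\<Gamma> \<in> sym0 d" using cone by (simp add: cnd_cone_def)
  have "\<Gamma> $$ (i, j) \<le> \<Gamma> $$ (i, k) + \<Gamma> $$ (j, k)"
    if C: "C \<in> cliques d E" and mem: "i \<in> C" "j \<in> C" "k \<in> C" for C i j k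
  proof -
    have complete: "is_complete d E C" using C by (simp add: cliques_def)
    have lt: "i < d" "j < d" "k < d" using complete mem by (auto simp: is_complete_def)
    have adj: "adjacent E a b" if "a \<in> C" "b \<in> C" "a \<noteq> b" for a b
      using complete that by (simp add: is_complete_def)
    have tri: "\<Gamma> $$ (a, b) \<le> \<Gamma> $$ (a, k) + \<Gamma> $$ (b, k)"
      if "a < b" "a \<in> C" "b \<in> C" "a < d" "b < d" "a \<noteq> k" "b \<noteq> k" for a b
      using le[OF Psi_of_triangle[of a d b k E]] that lt mem adj by simp
    consider "i = j" | "i = k" | "j = k" | "i < j" "i \<noteq> k" "j \<noteq> k" | "j < i" "i \<noteq> k" "j \<noteq> k"
      by linarith
    then show ?thesis
    proof cases
      case 1
      then show ?thesis using cnd_cone_nonneg[OF cone] sym0D(3)[OF sym0] lt by simp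
    next
      case 2
      then show ?thesis using sym0D[OF sym0] lt by simp
    next
      case 3
      then show ?thesis using sym0D[OF sym0] lt by simp
    next
      case 4
      then show ?thesis using tri mem lt by blast
    next
      case 5
      then have "\<Gamma> $$ (j, i) \<le> \<Gamma> $$ (j, k) + \<Gamma> $$ (i, k)" using tri mem lt by blast
      then show ?thesis using sym0D(4)[OF sym0] lt by simp
    qed
  qed
  then show "\<Gamma> \<in> S2_feasible d E" using cone by (simp add: S2_feasible_def)
qed

theorem proposition12:
  fixes d :: nat and E :: "(nat \<times> nat) set" and \<Gamma>bar Qhat :: "real mat"
  assumes "d \<ge> 1"
    and "E \<subseteq> edges d"
    and "connected_graph d E"
    and "\<Gamma>bar \<in> sym0 d"
    and "cond_neg_semidef d \<Gamma>bar"
    and "S1_estimate d E \<Gamma>bar Qhat"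
  shows "S2_feasible d E = {\<Gamma> \<in> cnd_cone d. \<forall>\<psi>\<in>Psi d E. g \<psi> \<Gamma> \<le> 0} \<and>
    (\<forall>\<eta>\<in>multipliers d E. dual_objective d E Qhat \<eta> = tree_objective d E Qhat \<eta>) \<and>
    {\<eta>. is_arg_max (dual_objective d E Qhat) (\<lambda>\<eta>. \<eta> \<in> multipliers d E) \<eta>} =
      {\<eta>. is_arg_max (tree_objective d E Qhat) (\<lambda>\<eta>. \<eta> \<in> multipliers d E) \<eta>}"
proof -
  obtain n where n: "d = Suc n" using assms(1) by (cases d) auto
  have "Qhat \<in> sym0 (Suc n)"
    using assms(6) by (simp add: n S1_estimate_def is_arg_min_def Q_space_def)
  then have "dual_objective d E Qhat = tree_objective d E Qhat"
    unfolding n by (intro ext dual_objective_eq_tree_objective)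
  then show ?thesis using S2_feasible_eq[OF assms(2)] by simp
qed

end
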